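(* Let $J_0\subset\mathbb{R}$ be a finite open interval, let $\varphi:J_0\to\mathbb{R}$ be a continuously differentiable function satisfying $$\sup_{x\in J_0}|\varphi'(x)|<\infty,\qquad \#\{x\in J_0:\varphi(x)=x\}<\infty,$$ and let $J\subset J_0$ be an interval of positive length. Let $n\ge 3$ be an integer and let $0<\gamma<1$. For a constant $c_1>0$ and a real number $Q>1$ put $$\tilde M^n_\varphi(Q,\gamma,J)=\left\{\boldsymbol{\alpha}=(\alpha_1,\alpha_2)\in\tilde{\mathbb{A}}_n^2(Q):\ \alpha_1\in J,\ |\varphi(\alpha_1)-\alpha_2|<c_1Q^{-\gamma}\right\}.$$ Then, provided the constant $c_1$ (independent of $Q$) is sufficiently large, there exist constants $c_2,c_3>0$ independent of $Q$ and a number $Q_0=Q_0(n,J,\varphi,\gamma)$ such that for all $Q>Q_0$ $$c_2\,Q^{n-\gamma}<\#\tilde M^n_\varphi(Q,\gamma,J)<c_3\,Q^{n-\gamma}.$$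
   Context: The height $H(P)$ of a polynomial $P\in\mathbb{Z}[t]$ is the maximum of the absolute values of its coefficients. An algebraic integer point is a point $\boldsymbol{\alpha}=(\alpha_1,\alpha_2)\in\mathbb{R}^2$ whose coordinates are two distinct (conjugate) roots of the same monic polynomial $P\in\mathbb{Z}[t]$ that is irreducible over $\mathbb{Q}$; $P$ is the minimal polynomial of $\boldsymbol{\alpha}$, and $\deg\boldsymbol{\alpha}:=\deg P$, $H(\boldsymbol{\alpha}):=H(P)$. $\tilde{\mathbb{A}}_n^2(Q)$ denotes the set of algebraic integer points $\boldsymbol{\alpha}$ with $\deg\boldsymbol{\alpha}=n$ and $H(\boldsymbol{\alpha})\le Q$. $\#S$ is the cardinality of a finite set $S$. The constants $c_1,c_2,c_3$ do not depend on $Q$, but may depend on the other data; $c_1$ is regarded as fixed when $c_2,c_3,Q_0$ are chosen. *)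

theory Defs
  imports "HOL-Analysis.Analysis" "HOL-Computational_Algebra.Computational_Algebra"
    "HOL-Computational_Algebra.Field_as_Ring"
begin

definition poly_height :: "int poly \<Rightarrow> int" where
  "poly_height P = Max ((\<lambda>i. \<bar>coeff P i\<bar>) ` {..degree P})"

definition is_min_poly :: "int poly \<Rightarrow> real \<times> real \<Rightarrow> bool" where
  "is_min_poly P \<alpha> \<longleftrightarrow>
     lead_coeff P = 1 \<and> irreducible (map_poly rat_of_int P) \<and> fst \<alpha> \<noteq> snd \<alpha> \<and>
     poly (map_poly real_of_int P) (fst \<alpha>) = 0 \<and> poly (map_poly real_of_int P) (snd \<alpha>) = 0"

definition algebraic_integer_point :: "real \<times> real \<Rightarrow> bool" where
  "algebraic_integer_point \<alpha> \<longleftrightarrow> (\<exists>P. is_min_poly P \<alpha>)"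

definition min_poly :: "real \<times> real \<Rightarrow> int poly" where
  "min_poly \<alpha> = (THE P. is_min_poly P \<alpha>)"

definition point_degree :: "real \<times> real \<Rightarrow> nat" where
  "point_degree \<alpha> = degree (min_poly \<alpha>)"

definition point_height :: "real \<times> real \<Rightarrow> int" where
  "point_height \<alpha> = poly_height (min_poly \<alpha>)"

definition algebraic_integer_points :: "nat \<Rightarrow> real \<Rightarrow> (real \<times> real) set" where
  "algebraic_integer_points n Q =
     {\<alpha>. algebraic_integer_point \<alpha> \<and> point_degree \<alpha> = n \<and> real_of_int (point_height \<alpha>) \<le> Q}"

definition points_near_curve ::
    "nat \<Rightarrow> (real \<Rightarrow> real) \<Rightarrow> real \<Rightarrow> real \<Rightarrow> real \<Rightarrow> real set \<Rightarrow> (real \<times> real) set" where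
  "points_near_curve n \<phi> c\<^sub>1 Q \<gamma> J =
     {(\<alpha>\<^sub>1, \<alpha>\<^sub>2) \<in> algebraic_integer_points n Q.
        \<alpha>\<^sub>1 \<in> J \<and> \<bar>\<phi> \<alpha>\<^sub>1 - \<alpha>\<^sub>2\<bar> < c\<^sub>1 * Q powr (-\<gamma>)}"

lemma map_poly_of_rat_mult:
  "map_poly real_of_rat (p * q) = map_poly real_of_rat p * map_poly real_of_rat q"
  by (simp add: poly_eq_iff coeff_map_poly coeff_mult of_rat_sum of_rat_mult)

lemma map_poly_of_rat_add:
  "map_poly real_of_rat (p + q) = map_poly real_of_rat p + map_poly real_of_rat q"
  by (simp add: poly_eq_iff coeff_map_poly of_rat_add)

lemma is_min_poly_unique:
  assumes P: "is_min_poly P \<alpha>" and R: "is_min_poly R \<alpha>"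
  shows "P = R"
proof -
  define p r where "p = map_poly rat_of_int P" and "r = map_poly rat_of_int R"
  have pr: "irreducible p" "irreducible r" "lead_coeff p = 1" "lead_coeff r = 1"
    using P R by (simp_all add: is_min_poly_def p_def r_def coeff_map_poly degree_map_poly)
  have real: "map_poly real_of_rat p = map_poly real_of_int P"
             "map_poly real_of_rat r = map_poly real_of_int R"
    by (simp_all add: p_def r_def poly_eq_iff coeff_map_poly)
  have "\<not> coprime p r"
  proof
    assume "coprime p r"
    then obtain u v where "u * p + v * r = 1"
      using bezout_coefficients_fst_snd[of p r] by (metis coprime_imp_gcd_eq_1)
    then have "poly (map_poly real_of_rat (u * p + v * r)) (fst \<alpha>) = 1"
      by simp
    then show False
      using P R by (simp add: map_poly_of_rat_mult map_poly_of_rat_add real is_min_poly_def)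
  qed
  then have "p dvd r" "r dvd p"
    using pr by (metis coprime_commute irreducible_imp_prime_elem prime_elem_imp_coprime)+
  moreover have "normalize p = p" "normalize r = r"
    by (rule poly_eqI, simp only: coeff_normalize pr unit_factor_1 div_by_1)+
  ultimately have "p = r"
    by (rule associated_eqI)
  then show "P = R"
    by (simp add: p_def r_def poly_eq_iff coeff_map_poly)
qed

lemma min_poly_eq: "is_min_poly P \<alpha> \<Longrightarrow> min_poly \<alpha> = P"
  unfolding min_poly_def using is_min_poly_unique by blast

end

theory Submission
  imports Defs
begin

text \<open>
  Dividing a monic polynomial \<open>P\<close> of degree \<open>n\<close> by \<open>(t - x) (t - y)\<close> leaves a remainder whose two
  coefficients are the two lowest coefficients of \<open>P\<close> plus quantities depending only on the higher
  coefficients and, in a Lipschitz way, on \<open>(x, y)\<close>.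

  Upper bound: the strip around the curve is covered by about \<open>Q\<^sup>\<gamma>\<close> squares of side about
  \<open>Q\<^bsup>-\<gamma>\<^esup>\<close>. If the two roots lie in a given square, then the higher coefficients can be
  chosen in \<open>O(Q\<^bsup>n-2\<^esup>)\<close> ways and confine each of the two lowest ones to an interval of length
  \<open>O(Q\<^bsup>1-\<gamma>\<^esup>)\<close>. As the remainder vanishes exactly, this also works near the diagonal.

  Lower bound: away from the fixed points of \<open>\<phi>\<close> take \<open>P\<close> with quadratic coefficient
  comparable to \<open>Q\<close> and dominating the quotient, and with the two lowest coefficients making the
  remainder at \<open>(x, \<phi> x)\<close> of size \<open>O(Q\<^bsup>1-\<gamma>\<^esup>)\<close>. Then \<open>P\<close> changes sign near \<open>x\<close> and
  near \<open>\<phi> x\<close>. Imposing the Eisenstein congruences at 2 costs only a constant factor and gives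
  irreducibility.
\<close>

section \<open>Irreducibility\<close>

lemma clear_denominators:
  fixes f :: "rat poly"
  obtains c :: int and F :: "int poly"
  where "c > 0" "map_poly rat_of_int F = smult (of_int c) f"
proof -
  have "\<exists>c>0. \<exists>F. map_poly rat_of_int F = smult (of_int c) f"
  proof (induction f)
    case 0
    show ?case by (rule exI[of _ 1]) (auto intro: exI[of _ 0])
  next
    case (pCons a f)
    then obtain c F where c: "c > 0" and F: "map_poly rat_of_int F = smult (of_int c) f"
      by blast
    obtain k d :: int where a: "a = of_int k / of_int d" and d: "d > 0"
      by (cases a) (auto simp: Fract_of_int_quotient)
    have "map_poly rat_of_int (pCons (k * c) (smult d F)) = smult (of_int (c * d)) (pCons a f)"
      using d arg_cong[OF F, of "\<lambda>p. smult (of_int d) p"]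
      by (simp add: poly_eq_iff coeff_pCons coeff_map_poly a split: nat.split)
    moreover have "c * d > 0"
      using c d by simp
    ultimately show ?case by blast
  qed
  then show ?thesis using that by blast
qed

text \<open>Gauss's lemma for monic \<open>P\<close>. After clearing denominators,
  \<open>F * G\<close> is a positive integer multiple of \<open>P\<close>. As \<open>P\<close> has
  content 1, passing to primitive parts, which is multiplicative, removes the multiple and keeps the
  degrees.\<close>

lemma gauss_factor_int:
  fixes P :: "int poly" and f g :: "rat poly"
  assumes monic: "lead_coeff P = 1" and fg: "map_poly rat_of_int P = f * g"
  obtains F G where "P = F * G" "degree F = degree f" "degree G = degree g"
proof -
  obtain c F where c: "c > 0" and F: "map_poly rat_of_int F = smult (of_int c) f"
    using clear_denominators by blast
  obtain d G where d: "d > 0" and G: "map_poly rat_of_int G = smult (of_int d) g"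
    using clear_denominators by blast
  have deg: "degree F = degree f" "degree G = degree g"
    using arg_cong[OF F, of degree] arg_cong[OF G, of degree] c d
    by (simp_all add: degree_map_poly)
  have "map_poly rat_of_int (F * G) = map_poly rat_of_int F * map_poly rat_of_int G"
    by (simp add: poly_eq_iff coeff_map_poly coeff_mult)
  also have "\<dots> = map_poly rat_of_int (smult (c * d) P)"
    by (simp add: F G fg[symmetric] poly_eq_iff coeff_map_poly mult_ac)
  finally have "rat_of_int (coeff (F * G) k) = rat_of_int (coeff (smult (c * d) P) k)" for k
    by (metis coeff_map_poly of_int_0)
  then have prod: "F * G = smult (c * d) P"
    unfolding of_int_eq_iff by (rule poly_eqI)
  have "content P = 1"
    using content_dvd_coeff[of P "degree P"] monic
    by (metis content_eq_zero_iff is_unit_content_iff leading_coeff_0_iff)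
  then have "primitive_part (F * G) = P"
    using c d unfolding prod by (simp add: primitive_part_smult primitive_part_prim)
  then have "P = primitive_part F * primitive_part G"
    by (simp add: primitive_part_mult)
  then show ?thesis
    using that deg by simp
qed

text \<open>Eisenstein's criterion at 2. The lowest odd coefficients of two factors combine to an
  odd coefficient of \<open>P\<close>, which can only be the leading one. So both factors are even
  below their leading terms, and two nonconstant factors would force 4 to divide the constant
  term.\<close>

lemma eisenstein_two:
  fixes P :: "int poly"
  assumes monic: "lead_coeff P = 1" and deg: "degree P > 0"
    and even: "\<And>i. i < degree P \<Longrightarrow> even (coeff P i)" and four: "\<not> 4 dvd coeff P 0"
  shows "irreducible (map_poly rat_of_int P)"
proof (rule irreducibleI)
  have degQ: "degree (map_poly rat_of_int P) = degree P"
    by (simp add: degree_map_poly)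
  show "map_poly rat_of_int P \<noteq> 0"
    using deg degQ by auto
  show "\<not> is_unit (map_poly rat_of_int P)"
    using deg degQ by (auto simp: is_unit_iff_degree \<open>map_poly rat_of_int P \<noteq> 0\<close>)
  fix f g assume fg: "map_poly rat_of_int P = f * g"
  then obtain F G where FG: "P = F * G" and dF: "degree F = degree f" and dG: "degree G = degree g"
    using gauss_factor_int[OF monic] by metis
  have nz: "F \<noteq> 0" "G \<noteq> 0" "f \<noteq> 0" "g \<noteq> 0"
    using FG deg fg \<open>map_poly rat_of_int P \<noteq> 0\<close> by auto
  \<comment> \<open>The leading coefficients multiply to 1, hence are odd; so the
    \<open>LEAST\<close> indices below exist and are at most the degrees.\<close>
  have lead: "odd (coeff F (degree F))" "odd (coeff G (degree G))"
    using monic unfolding FG lead_coeff_mult by (metis dvd_mult2 dvd_mult odd_one)+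
  define i where "i = (LEAST k. odd (coeff F k))"
  define j where "j = (LEAST k. odd (coeff G k))"
  have i: "odd (coeff F i)" "\<And>k. k < i \<Longrightarrow> even (coeff F k)" "i \<le> degree F"
    unfolding i_def using LeastI[of "\<lambda>k. odd (coeff F k)", OF lead(1)]
      Least_le[of "\<lambda>k. odd (coeff F k)", OF lead(1)]
    by (auto dest: not_less_Least)
  have j: "odd (coeff G j)" "\<And>k. k < j \<Longrightarrow> even (coeff G k)" "j \<le> degree G"
    unfolding j_def using LeastI[of "\<lambda>k. odd (coeff G k)", OF lead(2)]
      Least_le[of "\<lambda>k. odd (coeff G k)", OF lead(2)]
    by (auto dest: not_less_Least)
  have "coeff P (i + j) = coeff F i * coeff G j + (\<Sum>k\<in>{..i+j} - {i}. coeff F k * coeff G (i + j - k))"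
    unfolding FG coeff_mult by (subst sum.remove[of _ i]) auto
  moreover have "even (\<Sum>k\<in>{..i+j} - {i}. coeff F k * coeff G (i + j - k))"
  proof (rule dvd_sum)
    fix k assume "k \<in> {..i+j} - {i}"
    then have "k < i \<or> i + j - k < j" by auto
    then show "even (coeff F k * coeff G (i + j - k))"
      using i(2) j(2) by auto
  qed
  ultimately have "odd (coeff P (i + j))"
    using i(1) j(1) by simp
  then have "\<not> i + j < degree P"
    using even by blast
  moreover have "degree P = degree F + degree G"
    unfolding FG using nz by (simp add: degree_mult_eq)
  ultimately have ij: "i = degree F" "j = degree G"
    using i(3) j(3) by linarith+
  have "degree F = 0 \<or> degree G = 0"
  proof (rule ccontr)
    assume "\<not> (degree F = 0 \<or> degree G = 0)"
    then have "even (coeff F 0)" "even (coeff G 0)"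
      using i(2) j(2) ij by auto
    then have "2 * 2 dvd coeff F 0 * coeff G 0"
      by (rule mult_dvd_mono)
    then show False
      using four by (simp add: FG coeff_mult_0)
  qed
  then show "is_unit f \<or> is_unit g"
    using nz by (auto simp: is_unit_iff_degree dF dG)
qed

section \<open>Division by a monic quadratic\<close>

text \<open>
  Modulo \<open>(t - x) (t - y)\<close>, the power \<open>t ^ i\<close> has remainder
  \<open>fst (rem2 x y i) + snd (rem2 x y i) * t\<close> and quotient \<open>quo2 x y t i\<close>.
\<close>

primrec rem2 :: "real \<Rightarrow> real \<Rightarrow> nat \<Rightarrow> real \<times> real" where
  "rem2 x y 0 = (1, 0)"
| "rem2 x y (Suc i) = (- (x * y) * snd (rem2 x y i), fst (rem2 x y i) + (x + y) * snd (rem2 x y i))"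

primrec quo2 :: "real \<Rightarrow> real \<Rightarrow> real \<Rightarrow> nat \<Rightarrow> real" where
  "quo2 x y t 0 = 0"
| "quo2 x y t (Suc i) = snd (rem2 x y i) + t * quo2 x y t i"

lemma power_eq_rem2_quo2:
  "t ^ i = fst (rem2 x y i) + snd (rem2 x y i) * t + (t - x) * (t - y) * quo2 x y t i"
proof (induction i)
  case (Suc i)
  have "t ^ Suc i = t * (fst (rem2 x y i) + snd (rem2 x y i) * t + (t - x) * (t - y) * quo2 x y t i)"
    using Suc by simp
  then show ?case by (simp add: algebra_simps)
qed simp

text \<open>One step of the recursions multiplies a common bound by at most \<open>1 + 2 * B\<close>
  or \<open>B\<^sup>2\<close>; since \<open>1 \<le> B\<close>, the crude factor
  \<open>4 * B\<^sup>2\<close> serves all three quantities at once.\<close>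

lemma rem2_quo2_bound:
  assumes B: "B \<ge> 1" and xyt: "\<bar>x\<bar> \<le> B" "\<bar>y\<bar> \<le> B" "\<bar>t\<bar> \<le> B"
  shows "\<bar>fst (rem2 x y i)\<bar> \<le> (4 * B\<^sup>2) ^ i \<and> \<bar>snd (rem2 x y i)\<bar> \<le> (4 * B\<^sup>2) ^ i
    \<and> \<bar>quo2 x y t i\<bar> \<le> (4 * B\<^sup>2) ^ i"
proof (induction i)
  case (Suc i)
  define M where "M = (4 * B\<^sup>2) ^ i"
  have M: "M \<ge> 0" by (simp add: M_def)
  have BB: "B \<le> B\<^sup>2" "1 \<le> B\<^sup>2"
    using B by (auto simp: power2_eq_square mult_le_cancel_left1)
      (metis mult_1 mult_mono' B zero_le_one order_trans)
  have IH: "\<bar>fst (rem2 x y i)\<bar> \<le> M" "\<bar>snd (rem2 x y i)\<bar> \<le> M" "\<bar>quo2 x y t i\<bar> \<le> M"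
    using Suc by (auto simp: M_def)
  have xy: "\<bar>x * y\<bar> \<le> B\<^sup>2"
    unfolding abs_mult power2_eq_square using B xyt by (intro mult_mono) auto
  have B2M: "M \<le> B\<^sup>2 * M" "B * M \<le> B\<^sup>2 * M"
    using mult_right_mono[OF BB(2) M] mult_right_mono[OF BB(1) M] by auto
  have 1: "\<bar>- (x * y) * snd (rem2 x y i)\<bar> \<le> B\<^sup>2 * M"
    unfolding abs_mult[of "-(x*y)"] abs_minus using IH xy by (intro mult_mono) auto
  have 2: "\<bar>(x + y) * snd (rem2 x y i)\<bar> \<le> (2 * B) * M"
    unfolding abs_mult using IH xyt B by (intro mult_mono) auto
  have 3: "\<bar>t * quo2 x y t i\<bar> \<le> B * M"
    unfolding abs_mult using IH xyt B by (intro mult_mono) auto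
  have "(4 * B\<^sup>2) ^ Suc i = 4 * (B\<^sup>2 * M)" by (simp add: M_def)
  then show ?case
    unfolding rem2.simps quo2.simps fst_conv snd_conv using 1 2 3 IH B2M M by linarith
qed simp

text \<open>Product rule for Lipschitz constants: \<open>D\<close> and \<open>E\<close> belong to
  the two factors, \<open>R\<close> and \<open>S\<close> bound them.\<close>

lemma abs_mult_diff_le:
  fixes u v :: real
  assumes "\<bar>u - u'\<bar> \<le> D * d" "\<bar>v - v'\<bar> \<le> E * d" "\<bar>u\<bar> \<le> R" "\<bar>v'\<bar> \<le> S"
    "d \<ge> 0" "D \<ge> 0" "E \<ge> 0"
  shows "\<bar>u * v - u' * v'\<bar> \<le> (R * E + S * D) * d"
proof -
  have "u * v - u' * v' = u * (v - v') + v' * (u - u')"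
    by (simp add: algebra_simps)
  also have "\<bar>\<dots>\<bar> \<le> R * (E * d) + S * (D * d)"
    using assms by (intro order_trans[OF abs_triangle_ineq] add_mono)
      (simp_all add: abs_mult mult_mono)
  finally show ?thesis by (simp add: algebra_simps)
qed

text \<open>Both components are polynomials in \<open>(x, y)\<close>, hence Lipschitz on the box;
  the induction makes this explicit through the product rule. The constant precedes
  \<open>d\<close>, so it can be used at every scale.\<close>

lemma rem2_lipschitz:
  assumes B: "B \<ge> 1"
  shows "\<exists>D\<ge>0. \<forall>x y x' y' d. \<bar>x\<bar> \<le> B \<longrightarrow> \<bar>y\<bar> \<le> B \<longrightarrow> \<bar>x'\<bar> \<le> B \<longrightarrow> \<bar>y'\<bar> \<le> B \<longrightarrow>
    \<bar>x - x'\<bar> \<le> d \<longrightarrow> \<bar>y - y'\<bar> \<le> d \<longrightarrow>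
    \<bar>fst (rem2 x y i) - fst (rem2 x' y' i)\<bar> \<le> D * d \<and>
    \<bar>snd (rem2 x y i) - snd (rem2 x' y' i)\<bar> \<le> D * d"
proof (induction i)
  case 0
  then show ?case by (auto intro: exI[of _ 0])
next
  case (Suc i)
  then obtain D where D: "D \<ge> 0" and IH: "\<And>x y x' y' d. \<lbrakk>\<bar>x\<bar> \<le> B; \<bar>y\<bar> \<le> B; \<bar>x'\<bar> \<le> B; \<bar>y'\<bar> \<le> B;
    \<bar>x - x'\<bar> \<le> d; \<bar>y - y'\<bar> \<le> d\<rbrakk> \<Longrightarrow> \<bar>fst (rem2 x y i) - fst (rem2 x' y' i)\<bar> \<le> D * d \<and>
    \<bar>snd (rem2 x y i) - snd (rem2 x' y' i)\<bar> \<le> D * d"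
    by blast
  define M where "M = (4 * B\<^sup>2) ^ i"
  have M: "M \<ge> 0" by (simp add: M_def)
  \<comment> \<open>The first bracket comes from \<open>x * y\<close>, bounded by
    \<open>B\<^sup>2\<close> with constant \<open>B + B\<close>; the second from the summand
    \<open>fst\<close> and from \<open>x + y\<close>, bounded by \<open>2 * B\<close> with constant
    2. The sum covers both components.\<close>
  define D' where "D' = (B\<^sup>2 * D + M * (B + B)) + (D + (2 * B * D + M * 2))"
  have D': "D' \<ge> 0"
    using D M B by (auto simp: D'_def)
  show ?case
  proof (intro exI[of _ D'] conjI D' allI impI)
    fix x y x' y' d
    assume a: "\<bar>x\<bar> \<le> B" "\<bar>y\<bar> \<le> B" "\<bar>x'\<bar> \<le> B" "\<bar>y'\<bar> \<le> B" "\<bar>x - x'\<bar> \<le> d" "\<bar>y - y'\<bar> \<le> d"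
    have d: "d \<ge> 0" using a by linarith
    note ih = IH[OF a]
    have bd: "\<bar>snd (rem2 x' y' i)\<bar> \<le> M"
      using rem2_quo2_bound[OF B a(3,4) a(3)] by (simp add: M_def)
    have xy: "\<bar>x * y\<bar> \<le> B\<^sup>2"
      unfolding abs_mult power2_eq_square using B a by (intro mult_mono) auto
    have "\<bar>x * y - x' * y'\<bar> \<le> (B * 1 + B * 1) * d"
      using a d by (intro abs_mult_diff_le) auto
    then have 1: "\<bar>x * y * snd (rem2 x y i) - x' * y' * snd (rem2 x' y' i)\<bar>
        \<le> (B\<^sup>2 * D + M * (B + B)) * d"
      using ih bd xy d D B by (intro abs_mult_diff_le) auto
    have 2: "\<bar>(x + y) * snd (rem2 x y i) - (x' + y') * snd (rem2 x' y' i)\<bar> \<le> (2 * B * D + M * 2) * d"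
      using ih bd a d D B by (intro abs_mult_diff_le) auto
    have ge: "(B\<^sup>2 * D + M * (B + B)) * d \<ge> 0" "D * d \<ge> 0" "(2 * B * D + M * 2) * d \<ge> 0"
      using D M B d by auto
    have eq: "D' * d = (B\<^sup>2 * D + M * (B + B)) * d + (D * d + (2 * B * D + M * 2) * d)"
      by (simp only: D'_def distrib_right)
    show "\<bar>fst (rem2 x y (Suc i)) - fst (rem2 x' y' (Suc i))\<bar> \<le> D' * d"
      using 1 ge unfolding eq by simp
    show "\<bar>snd (rem2 x y (Suc i)) - snd (rem2 x' y' (Suc i))\<bar> \<le> D' * d"
      using 2 ih ge unfolding eq rem2.simps snd_conv by linarith
  qed
qed

lemma rem2_lipschitz_uniform:
  assumes B: "B \<ge> 1"
  obtains D where "D \<ge> 0" "\<And>i x y x' y' d. \<lbrakk>i \<le> n; \<bar>x\<bar> \<le> B; \<bar>y\<bar> \<le> B; \<bar>x'\<bar> \<le> B; \<bar>y'\<bar> \<le> B;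
    \<bar>x - x'\<bar> \<le> d; \<bar>y - y'\<bar> \<le> d\<rbrakk> \<Longrightarrow> \<bar>fst (rem2 x y i) - fst (rem2 x' y' i)\<bar> \<le> D * d \<and>
    \<bar>snd (rem2 x y i) - snd (rem2 x' y' i)\<bar> \<le> D * d"
proof -
  obtain E where E: "\<And>i. E i \<ge> 0" "\<And>i x y x' y' d. \<lbrakk>\<bar>x\<bar> \<le> B; \<bar>y\<bar> \<le> B; \<bar>x'\<bar> \<le> B; \<bar>y'\<bar> \<le> B;
    \<bar>x - x'\<bar> \<le> d; \<bar>y - y'\<bar> \<le> d\<rbrakk> \<Longrightarrow> \<bar>fst (rem2 x y i) - fst (rem2 x' y' i)\<bar> \<le> E i * d \<and>
    \<bar>snd (rem2 x y i) - snd (rem2 x' y' i)\<bar> \<le> E i * d"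
    using rem2_lipschitz[OF B] by metis
  show ?thesis
  proof (rule that[of "\<Sum>i\<le>n. E i"])
    show "0 \<le> (\<Sum>i\<le>n. E i)"
      using E(1) by (simp add: sum_nonneg)
    fix i x y x' y' d
    assume i: "i \<le> n"
      and a: "\<bar>x\<bar> \<le> B" "\<bar>y\<bar> \<le> B" "\<bar>x'\<bar> \<le> B" "\<bar>y'\<bar> \<le> B" "\<bar>x - x'\<bar> \<le> d" "\<bar>y - y'\<bar> \<le> d"
    have "E i \<le> (\<Sum>i\<le>n. E i)"
      using i E(1) by (intro member_le_sum) auto
    moreover have "d \<ge> 0" using a by linarith
    ultimately have "E i * d \<le> (\<Sum>i\<le>n. E i) * d"
      by (rule mult_right_mono)
    then show "\<bar>fst (rem2 x y i) - fst (rem2 x' y' i)\<bar> \<le> (\<Sum>i\<le>n. E i) * d \<and>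
      \<bar>snd (rem2 x y i) - snd (rem2 x' y' i)\<bar> \<le> (\<Sum>i\<le>n. E i) * d"
      using E(2)[OF a, of i] by linarith
  qed
qed

text \<open>The index \<open>n\<close> carries the leading coefficient 1, so \<open>f n\<close> is ignored.\<close>

definition tail_comb :: "nat \<Rightarrow> (nat \<Rightarrow> int) \<Rightarrow> (nat \<Rightarrow> real) \<Rightarrow> real" where
  "tail_comb n f u = (\<Sum>i = 2..<n. of_int (f i) * u i) + u n"

lemma tail_comb_cong:
  "(\<And>i. i \<in> {2..<n} \<Longrightarrow> f i = g i) \<Longrightarrow> tail_comb n f u = tail_comb n g u"
  by (simp add: tail_comb_def)

lemma tail_comb_diff: "tail_comb n f u - tail_comb n f v = tail_comb n f (\<lambda>i. u i - v i)"
  by (simp add: tail_comb_def sum_subtractf algebra_simps)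

lemma tail_comb_bound:
  assumes f: "\<And>i. i \<in> {2..<n} \<Longrightarrow> \<bar>real_of_int (f i)\<bar> \<le> H" and u: "\<And>i. i \<le> n \<Longrightarrow> \<bar>u i\<bar> \<le> M"
    and H: "H \<ge> 0"
  shows "\<bar>tail_comb n f u\<bar> \<le> (real n * H + 1) * M"
proof -
  have M: "M \<ge> 0" using u[of 0] by linarith
  have "\<bar>\<Sum>i = 2..<n. of_int (f i) * u i\<bar> \<le> (\<Sum>i = 2..<n. H * M)"
    using f u H by (intro order_trans[OF sum_abs] sum_mono) (auto simp: abs_mult intro!: mult_mono)
  also have "\<dots> = real (n - 2) * (H * M)"
    by simp
  also have "\<dots> \<le> real n * (H * M)"
    using H M by (intro mult_right_mono) auto
  finally have "\<bar>\<Sum>i = 2..<n. of_int (f i) * u i\<bar> \<le> real n * (H * M)" .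
  then show ?thesis
    using u[of n] unfolding tail_comb_def by (simp add: algebra_simps)
qed

lemma tail_comb_power:
  "tail_comb n f (\<lambda>i. t ^ i) = tail_comb n f (\<lambda>i. fst (rem2 x y i)) + tail_comb n f (\<lambda>i. snd (rem2 x y i)) * t
    + (t - x) * (t - y) * tail_comb n f (quo2 x y t)"
  unfolding tail_comb_def power_eq_rem2_quo2[of t _ x y]
  by (simp add: algebra_simps sum.distrib sum_distrib_left sum_subtractf)

lemma poly_monic_eq_tail_comb:
  fixes P :: "int poly"
  assumes "lead_coeff P = 1" "degree P = n" "n \<ge> 2"
  shows "poly (map_poly real_of_int P) t
    = of_int (coeff P 0) + of_int (coeff P 1) * t + tail_comb n (coeff P) (\<lambda>i. t ^ i)"
proof -
  have "poly (map_poly real_of_int P) t = (\<Sum>i\<le>n. of_int (coeff P i) * t ^ i)"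
    using assms by (simp add: poly_altdef degree_map_poly coeff_map_poly)
  also have "{..n} = {0, 1} \<union> {2..<n} \<union> {n}"
    using assms by auto
  also have "(\<Sum>i\<in>\<dots>. of_int (coeff P i) * t ^ i)
      = of_int (coeff P 0) + of_int (coeff P 1) * t + tail_comb n (coeff P) (\<lambda>i. t ^ i)"
    using assms by (subst sum.union_disjoint; auto)+ (auto simp: tail_comb_def)
  finally show ?thesis .
qed

text \<open>Division with remainder follows by linearity from that of the powers. The powers 1 and
  \<open>t\<close> are their own remainders, so the two lowest coefficients enter the remainder as
  free additive terms; this is what allows counting them.\<close>

lemma poly_monic_division:
  fixes P :: "int poly"
  assumes "lead_coeff P = 1" "degree P = n" "n \<ge> 2"
  shows "poly (map_poly real_of_int P) t
    = (t - x) * (t - y) * tail_comb n (coeff P) (quo2 x y t)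
      + ((of_int (coeff P 0) + tail_comb n (coeff P) (\<lambda>i. fst (rem2 x y i)))
      + (of_int (coeff P 1) + tail_comb n (coeff P) (\<lambda>i. snd (rem2 x y i))) * t)"
  unfolding poly_monic_eq_tail_comb[OF assms] tail_comb_power[of n _ t x y]
  by (simp add: algebra_simps)

text \<open>The remainder is affine and vanishes at two distinct points, so it is zero. The size of
  \<open>x - y\<close> does not enter, hence there is no loss near the diagonal.\<close>

lemma low_coeffs_of_two_roots:
  fixes P :: "int poly"
  assumes P: "lead_coeff P = 1" "degree P = n" "n \<ge> 2" and xy: "x \<noteq> y"
    and roots: "poly (map_poly real_of_int P) x = 0" "poly (map_poly real_of_int P) y = 0"
  shows "of_int (coeff P 0) = - tail_comb n (coeff P) (\<lambda>i. fst (rem2 x y i))"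
    and "of_int (coeff P 1) = - tail_comb n (coeff P) (\<lambda>i. snd (rem2 x y i))"
proof -
  define A where "A = of_int (coeff P 0) + tail_comb n (coeff P) (\<lambda>i. fst (rem2 x y i))"
  define D where "D = of_int (coeff P 1) + tail_comb n (coeff P) (\<lambda>i. snd (rem2 x y i))"
  have "A + D * x = 0" "A + D * y = 0"
    using roots poly_monic_division[OF P, of x x y] poly_monic_division[OF P, of y x y]
    by (simp_all add: A_def D_def)
  moreover from this have "D * (x - y) = 0"
    unfolding right_diff_distrib by linarith
  ultimately have "D = 0" "A = 0"
    using xy by auto
  then show "of_int (coeff P 0) = - tail_comb n (coeff P) (\<lambda>i. fst (rem2 x y i))"
    and "of_int (coeff P 1) = - tail_comb n (coeff P) (\<lambda>i. snd (rem2 x y i))"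
    by (simp_all add: A_def D_def)
qed

section \<open>Counting polynomials\<close>

lemma int_ball_eq: "{m::int. \<bar>real_of_int m - c\<bar> \<le> w} = {\<lceil>c - w\<rceil>..\<lfloor>c + w\<rfloor>}"
  by (auto simp: ceiling_le_iff le_floor_iff abs_le_iff)

lemma finite_int_ball: "finite {m::int. \<bar>real_of_int m - c\<bar> \<le> w}"
  unfolding int_ball_eq by simp

lemma card_int_ball_le:
  assumes "w \<ge> 0" shows "real (card {m::int. \<bar>real_of_int m - c\<bar> \<le> w}) \<le> 2 * w + 1"
proof -
  have "real_of_int (\<lfloor>c + w\<rfloor> - \<lceil>c - w\<rceil> + 1) \<le> 2 * w + 1"
    by (simp, linarith)
  then show ?thesis
    unfolding int_ball_eq using assms by (simp add: of_nat_nat nat_le_iff max_def)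
qed

lemma card_int_ball_ge: "real (card {m::int. \<bar>real_of_int m - c\<bar> \<le> w}) \<ge> 2 * w - 1"
proof -
  have "real_of_int (\<lfloor>c + w\<rfloor> - \<lceil>c - w\<rceil> + 1) \<ge> 2 * w - 1"
    by (simp, linarith)
  then show ?thesis
    unfolding int_ball_eq by simp
qed

lemma finite_bounded_monic_polys:
  "finite {P :: int poly. lead_coeff P = 1 \<and> degree P = n \<and> (\<forall>i. \<bar>real_of_int (coeff P i)\<bar> \<le> Q)}"
    (is "finite ?A")
proof (rule finite_imageD)
  have "(\<lambda>P. restrict (coeff P) {..n}) ` ?A \<subseteq> (\<Pi>\<^sub>E i\<in>{..n}. {m::int. \<bar>real_of_int m - 0\<bar> \<le> Q})"
    by (auto intro!: restrict_PiE_iff[THEN iffD2])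
  then show "finite ((\<lambda>P. restrict (coeff P) {..n}) ` ?A)"
    by (rule finite_subset) (intro finite_PiE finite_int_ball, simp)
  show "inj_on (\<lambda>P. restrict (coeff P) {..n}) ?A"
  proof (rule inj_onI)
    fix P R assume "P \<in> ?A" "R \<in> ?A" and eq: "restrict (coeff P) {..n} = restrict (coeff R) {..n}"
    then have deg: "degree P = n" "degree R = n" by auto
    show "P = R"
    proof (rule poly_eqI)
      fix i show "coeff P i = coeff R i"
        using fun_cong[OF eq, of i] deg by (cases "i \<le> n") (auto simp: coeff_eq_0)
    qed
  qed
qed

text \<open>With \<open>u\<close> and \<open>v\<close> the components of \<open>rem2\<close> at a
  reference point, the last two conditions say that the remainder of \<open>P\<close> there has
  coefficients of size at most \<open>w\<close>.\<close>

definition poly_cell :: "nat \<Rightarrow> real \<Rightarrow> (nat \<Rightarrow> real) \<Rightarrow> (nat \<Rightarrow> real) \<Rightarrow> real \<Rightarrow> int poly set" where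
  "poly_cell n Q u v w = {P. lead_coeff P = 1 \<and> degree P = n \<and> (\<forall>i. \<bar>real_of_int (coeff P i)\<bar> \<le> Q) \<and>
     \<bar>of_int (coeff P 0) + tail_comb n (coeff P) u\<bar> \<le> w \<and>
     \<bar>of_int (coeff P 1) + tail_comb n (coeff P) v\<bar> \<le> w}"

text \<open>The coefficients from 2 to \<open>n - 1\<close> are chosen freely; once they are fixed,
  each of the two lowest ones is an integer in an interval of half-length \<open>w\<close>.\<close>

lemma poly_cell_card_le:
  assumes Q: "Q \<ge> 0" and w: "w \<ge> 0" and n: "n \<ge> 2"
  shows "finite (poly_cell n Q u v w)"
    and "real (card (poly_cell n Q u v w)) \<le> (2 * Q + 1) ^ (n - 2) * (2 * w + 1)\<^sup>2"
proof -
  define F where "F = (\<Pi>\<^sub>E i\<in>{2..<n}. {m::int. \<bar>real_of_int m - 0\<bar> \<le> Q})"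
  define I where "I u f = {m::int. \<bar>real_of_int m - (- tail_comb n f u)\<bar> \<le> w}" for u f
  define S where "S = Sigma F (\<lambda>f. I u f \<times> I v f)"
  \<comment> \<open>The omitted coefficients are 1 at \<open>n\<close> and 0 above, so
    \<open>h\<close> loses nothing.\<close>
  define h where "h P = (restrict (coeff P) {2..<n}, coeff P 0, coeff P 1)" for P :: "int poly"
  have finF: "finite F"
    unfolding F_def by (intro finite_PiE finite_int_ball) auto
  have finI: "finite (I u f)" for u f
    unfolding I_def by (rule finite_int_ball)
  have finS: "finite S"
    unfolding S_def using finF finI by auto
  show "finite (poly_cell n Q u v w)"
    by (rule finite_subset[OF _ finite_bounded_monic_polys[of n Q]]) (auto simp: poly_cell_def)
  have "h ` poly_cell n Q u v w \<subseteq> S"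
  proof
    fix s assume "s \<in> h ` poly_cell n Q u v w"
    then obtain P where P: "P \<in> poly_cell n Q u v w" and s: "s = h P" by blast
    have "tail_comb n (restrict (coeff P) {2..<n}) u = tail_comb n (coeff P) u" for u
      by (rule tail_comb_cong) simp
    then show "s \<in> S"
      using P by (auto simp: s h_def S_def F_def I_def poly_cell_def)
  qed
  moreover have "inj_on h (poly_cell n Q u v w)"
  proof (rule inj_onI)
    fix P R assume P: "P \<in> poly_cell n Q u v w" and R: "R \<in> poly_cell n Q u v w" and eq: "h P = h R"
    show "P = R"
    proof (rule poly_eqI)
      fix i
      consider "i = 0" | "i = 1" | "i \<in> {2..<n}" | "i = n" | "i > n" by force
      then show "coeff P i = coeff R i"
      proof cases
        case 3
        then show ?thesis using eq unfolding h_def by (metis prod.inject restrict_apply')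
      next
        case 5
        then show ?thesis using P R by (auto simp: poly_cell_def coeff_eq_0)
      qed (use eq P R in \<open>auto simp: h_def poly_cell_def\<close>)
    qed
  qed
  ultimately have "card (poly_cell n Q u v w) \<le> card S"
    using finS by (metis card_inj_on_le)
  also have "card S = (\<Sum>f\<in>F. card (I u f) * card (I v f))"
    unfolding S_def using finF finI by (subst card_SigmaI) (auto simp: card_cartesian_product)
  finally have "real (card (poly_cell n Q u v w)) \<le> (\<Sum>f\<in>F. real (card (I u f)) * real (card (I v f)))"
    unfolding of_nat_mult[symmetric] of_nat_sum[symmetric] by (rule of_nat_mono)
  also have "\<dots> \<le> (\<Sum>f\<in>F. (2 * w + 1) * (2 * w + 1))"
    unfolding I_def using w by (intro sum_mono mult_mono card_int_ball_le) auto
  also have "\<dots> = real (card F) * (2 * w + 1)\<^sup>2"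
    by (simp add: power2_eq_square)
  also have "real (card F) = real (card {m::int. \<bar>real_of_int m - 0\<bar> \<le> Q}) ^ (n - 2)"
    unfolding F_def by (subst card_PiE) auto
  also have "\<dots> * (2 * w + 1)\<^sup>2 \<le> (2 * Q + 1) ^ (n - 2) * (2 * w + 1)\<^sup>2"
    using Q by (intro mult_right_mono power_mono card_int_ball_le) auto
  finally show "real (card (poly_cell n Q u v w)) \<le> (2 * Q + 1) ^ (n - 2) * (2 * w + 1)\<^sup>2" .
qed

definition monic_poly :: "nat \<Rightarrow> (nat \<Rightarrow> int) \<Rightarrow> int poly" where
  "monic_poly n f = monom 1 n + (\<Sum>i<n. monom (f i) i)"

lemma coeff_monic_poly: "coeff (monic_poly n f) i = (if i < n then f i else if i = n then 1 else 0)"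
  by (auto simp: monic_poly_def coeff_sum)

lemma degree_monic_poly: "degree (monic_poly n f) = n"
  by (rule antisym) (auto intro!: degree_le le_degree simp: coeff_monic_poly)

text \<open>The centres \<open>c i\<close> and the radius \<open>r\<close> refer to the halves of
  the even coefficients, whence the factors 2. No height bound is built in; it has to follow from
  the choice of \<open>c\<close>, \<open>r\<close> and \<open>w\<close>.\<close>

definition eisenstein_cell ::
    "nat \<Rightarrow> (nat \<Rightarrow> real) \<Rightarrow> real \<Rightarrow> (nat \<Rightarrow> real) \<Rightarrow> (nat \<Rightarrow> real) \<Rightarrow> real \<Rightarrow> int poly set" where
  "eisenstein_cell n c r u v w = {P. lead_coeff P = 1 \<and> degree P = n \<and>
     (\<forall>i<n. even (coeff P i)) \<and> \<not> 4 dvd coeff P 0 \<and>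
     (\<forall>i\<in>{2..<n}. \<bar>real_of_int (coeff P i) - 2 * c i\<bar> \<le> 2 * r) \<and>
     \<bar>of_int (coeff P 0) + tail_comb n (coeff P) u\<bar> \<le> w \<and>
     \<bar>of_int (coeff P 1) + tail_comb n (coeff P) v\<bar> \<le> w}"

text \<open>The members are parametrised by free integers: \<open>4 * k + 2\<close> at index 0,
  \<open>2 * m\<close> at index 1 and \<open>2 * f i\<close> in between. Finiteness is left to the
  caller, since an infinite set would have \<open>card\<close> equal to 0.\<close>

lemma eisenstein_cell_card_ge:
  assumes n: "n \<ge> 2" and r: "r \<ge> 1" and w: "w \<ge> 4" and fin: "finite (eisenstein_cell n c r u v w)"
  shows "r ^ (n - 2) * w\<^sup>2 / 8 \<le> real (card (eisenstein_cell n c r u v w))"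
proof -
  define F where "F = (\<Pi>\<^sub>E i\<in>{2..<n}. {m::int. \<bar>real_of_int m - c i\<bar> \<le> r})"
  define T where "T f = tail_comb n (\<lambda>i. 2 * f i)" for f :: "nat \<Rightarrow> int"
  \<comment> \<open>Dividing the condition on \<open>4 * k + 2\<close> by 4 gives the centre, with
    the shift \<open>1 / 2\<close>, and the half-length \<open>w / 4\<close>.\<close>
  define I where "I f = {m::int. \<bar>real_of_int m - (- (T f u / 4) - 1 / 2)\<bar> \<le> w / 4}" for f
  define J where "J f = {m::int. \<bar>real_of_int m - (- (T f v / 2))\<bar> \<le> w / 2}" for f
  define S where "S = Sigma F (\<lambda>f. I f \<times> J f)"
  define g where "g f k m = (\<lambda>i. if i = 0 then 4 * k + 2 else if i = 1 then 2 * m else 2 * f i)"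
    for f :: "nat \<Rightarrow> int" and k m :: int
  define h where "h = (\<lambda>(f, k, m). monic_poly n (g f k m))"
  have finF: "finite F"
    unfolding F_def by (intro finite_PiE finite_int_ball) auto
  have finIJ: "finite (I f)" "finite (J f)" for f
    unfolding I_def J_def by (rule finite_int_ball)+
  have inj: "inj_on h S"
  proof (rule inj_onI)
    fix s s' assume s: "s \<in> S" "s' \<in> S" and eq: "h s = h s'"
    obtain f k m where s1: "s = (f, k, m)" "f \<in> F" using s(1) by (auto simp: S_def)
    obtain f' k' m' where s2: "s' = (f', k', m')" "f' \<in> F" using s(2) by (auto simp: S_def)
    have "g f k m i = g f' k' m' i" if "i < n" for i
      using that arg_cong[OF eq, of "\<lambda>P. coeff P i"] by (simp add: h_def s1 s2 coeff_monic_poly)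
    note this[of 0] this[of 1] this
    moreover from this(3) have "f i = f' i" if "i \<in> {2..<n}" for i
      using that n by (fastforce simp: g_def)
    then have "f = f'"
      using s1(2) s2(2) unfolding F_def by (rule_tac PiE_ext)
    ultimately show "s = s'"
      using n by (simp add: s1 s2 g_def)
  qed
  have sub: "h ` S \<subseteq> eisenstein_cell n c r u v w"
  proof
    fix P assume "P \<in> h ` S"
    then obtain f k m where P: "P = monic_poly n (g f k m)"
      and f: "f \<in> F" and k: "k \<in> I f" and m: "m \<in> J f"
      by (auto simp: S_def h_def)
    have tail: "tail_comb n (coeff P) u = T f u" for u
      unfolding T_def by (rule tail_comb_cong) (auto simp: P coeff_monic_poly g_def)
    have fb: "\<bar>2 * real_of_int (f i) - 2 * c i\<bar> \<le> 2 * r" if "i \<in> {2..<n}" for i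
    proof -
      have "\<bar>real_of_int (f i) - c i\<bar> \<le> r"
        using f that by (auto simp: F_def PiE_def Pi_def)
      then show ?thesis by linarith
    qed
    have c0: "coeff P 0 = 4 * k + 2" and c1: "coeff P 1 = 2 * m"
      using n by (auto simp: P coeff_monic_poly g_def)
    have "\<not> 4 dvd coeff P 0"
      unfolding c0 by presburger
    moreover have "\<bar>of_int (coeff P 0) + tail_comb n (coeff P) u\<bar> \<le> w"
      using k unfolding c0 tail I_def mem_Collect_eq of_int_add of_int_mult of_int_numeral by linarith
    moreover have "\<bar>of_int (coeff P 1) + tail_comb n (coeff P) v\<bar> \<le> w"
      using m unfolding c1 tail J_def mem_Collect_eq of_int_mult of_int_numeral by linarith
    moreover have "\<forall>i<n. even (coeff P i)"
      by (auto simp: P coeff_monic_poly g_def)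
    moreover have "\<forall>i\<in>{2..<n}. \<bar>real_of_int (coeff P i) - 2 * c i\<bar> \<le> 2 * r"
      using fb by (auto simp: P coeff_monic_poly g_def)
    moreover have "degree P = n" "lead_coeff P = 1"
      by (simp_all add: P degree_monic_poly coeff_monic_poly)
    ultimately show "P \<in> eisenstein_cell n c r u v w"
      by (simp add: eisenstein_cell_def)
  qed
  have "r ^ (n - 2) = (\<Prod>i\<in>{2..<n}. r)"
    by simp
  also have "\<dots> \<le> (\<Prod>i\<in>{2..<n}. real (card {m::int. \<bar>real_of_int m - c i\<bar> \<le> r}))"
    using r by (intro prod_mono conjI order_trans[OF _ card_int_ball_ge]) auto
  also have "\<dots> = real (card F)"
    unfolding F_def by (subst card_PiE) auto
  finally have "r ^ (n - 2) * (w\<^sup>2 / 8) \<le> real (card F) * (w\<^sup>2 / 8)"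
    by (rule mult_right_mono) simp
  \<comment> \<open>For \<open>w \<ge> 4\<close> the two intervals contain at least
    \<open>w / 2 - 1 \<ge> w / 4\<close> and \<open>w - 1 \<ge> w / 2\<close> integers.\<close>
  also have "\<dots> = (\<Sum>f\<in>F. w / 4 * (w / 2))"
    by (simp add: power2_eq_square)
  also have "\<dots> \<le> (\<Sum>f\<in>F. real (card (I f)) * real (card (J f)))"
    unfolding I_def J_def using w by (intro sum_mono mult_mono order_trans[OF _ card_int_ball_ge]) auto
  also have "\<dots> = real (card S)"
    unfolding S_def using finF finIJ by (subst card_SigmaI) (auto simp: card_cartesian_product)
  also have "\<dots> \<le> real (card (eisenstein_cell n c r u v w))"
    using card_inj_on_le[OF inj sub fin] by simp
  finally show ?thesis by simp
qed

section \<open>The upper bound\<close>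

lemma poly_height_le_iff:
  assumes "Q \<ge> 0"
  shows "real_of_int (poly_height P) \<le> Q \<longleftrightarrow> (\<forall>i. \<bar>real_of_int (coeff P i)\<bar> \<le> Q)"
proof
  assume Q: "real_of_int (poly_height P) \<le> Q"
  show "\<forall>i. \<bar>real_of_int (coeff P i)\<bar> \<le> Q"
  proof
    fix i
    show "\<bar>real_of_int (coeff P i)\<bar> \<le> Q"
    proof (cases "i \<le> degree P")
      case True
      then have "\<bar>coeff P i\<bar> \<le> poly_height P"
        unfolding poly_height_def by (intro Max_ge) auto
      then show ?thesis using Q by linarith
    qed (use assms in \<open>simp add: coeff_eq_0\<close>)
  qed
next
  assume b: "\<forall>i. \<bar>real_of_int (coeff P i)\<bar> \<le> Q"
  have "poly_height P \<in> (\<lambda>i. \<bar>coeff P i\<bar>) ` {..degree P}"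
    unfolding poly_height_def by (rule Max_in) auto
  then show "real_of_int (poly_height P) \<le> Q"
    using b by auto
qed

text \<open>Uniqueness of the minimal polynomial turns the definite description into an existential
  statement, the only form used from here on.\<close>

lemma algebraic_integer_points_iff:
  assumes "Q \<ge> 0"
  shows "\<alpha> \<in> algebraic_integer_points n Q \<longleftrightarrow>
    (\<exists>P. is_min_poly P \<alpha> \<and> degree P = n \<and> (\<forall>i. \<bar>real_of_int (coeff P i)\<bar> \<le> Q))"
  unfolding algebraic_integer_points_def algebraic_integer_point_def point_degree_def point_height_def
    mem_Collect_eq poly_height_le_iff[OF assms]
  using min_poly_eq by metis

text \<open>A polynomial of degree \<open>n\<close> has at most \<open>n\<close> real roots, so it
  is the minimal polynomial of at most \<open>n\<^sup>2\<close> points.\<close>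

lemma card_points_le_of_polys:
  assumes fin: "finite \<P>" and P: "\<And>\<alpha>. \<alpha> \<in> S \<Longrightarrow> \<exists>P\<in>\<P>. is_min_poly P \<alpha> \<and> degree P = n"
  shows "finite S" and "card S \<le> n\<^sup>2 * card \<P>"
proof -
  define R where "R P = {x. poly (map_poly real_of_int P) x = 0}" for P :: "int poly"
  define \<P>' where "\<P>' = {P \<in> \<P>. lead_coeff P = 1 \<and> degree P = n}"
  have R: "finite (R P)" "card (R P) \<le> n" if "P \<in> \<P>'" for P
  proof -
    have "map_poly real_of_int P \<noteq> 0"
      using that by (auto simp: \<P>'_def map_poly_eq_0_iff)
    then show "finite (R P)" "card (R P) \<le> n"
      using poly_roots_finite card_poly_roots_bound[of "map_poly real_of_int P"] that
      by (auto simp: R_def \<P>'_def degree_map_poly)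
  qed
  have fin': "finite \<P>'" using fin by (simp add: \<P>'_def)
  have sub: "S \<subseteq> (\<Union>P\<in>\<P>'. R P \<times> R P)"
    using P by (fastforce simp: is_min_poly_def \<P>'_def R_def)
  have finU: "finite (\<Union>P\<in>\<P>'. R P \<times> R P)"
    using fin' R by auto
  then show "finite S"
    using sub finite_subset by blast
  have "card S \<le> card (\<Union>P\<in>\<P>'. R P \<times> R P)"
    using sub finU by (rule card_mono[rotated])
  also have "\<dots> \<le> (\<Sum>P\<in>\<P>'. card (R P \<times> R P))"
    using fin' by (rule card_UN_le)
  also have "\<dots> \<le> (\<Sum>P\<in>\<P>'. n * n)"
    unfolding card_cartesian_product using R by (intro sum_mono mult_mono) auto
  also have "\<dots> \<le> n\<^sup>2 * card \<P>"
    using fin by (auto simp: power2_eq_square \<P>'_def intro!: card_mono)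
  finally show "card S \<le> n\<^sup>2 * card \<P>" .
qed

lemma finite_algebraic_integer_points:
  assumes "Q \<ge> 0" shows "finite (algebraic_integer_points n Q)"
proof (rule card_points_le_of_polys(1)[OF finite_bounded_monic_polys[of n Q]])
  fix \<alpha> assume "\<alpha> \<in> algebraic_integer_points n Q"
  then show "\<exists>P\<in>{P. lead_coeff P = 1 \<and> degree P = n \<and> (\<forall>i. \<bar>real_of_int (coeff P i)\<bar> \<le> Q)}.
      is_min_poly P \<alpha> \<and> degree P = n"
    unfolding algebraic_integer_points_iff[OF assms] is_min_poly_def by blast
qed

text \<open>One point of \<open>S\<close> serves as reference. The remainder of a minimal polynomial
  vanishes at its own roots, so by the Lipschitz bound it is at most \<open>w\<close> at the
  reference point: all the minimal polynomials lie in a single \<open>poly_cell\<close>.\<close>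

lemma card_points_in_box_le:
  assumes n: "n \<ge> 2" and Q: "Q \<ge> 0" and S: "S \<subseteq> algebraic_integer_points n Q"
    and B: "\<And>\<alpha>. \<alpha> \<in> S \<Longrightarrow> \<bar>fst \<alpha>\<bar> \<le> B \<and> \<bar>snd \<alpha>\<bar> \<le> B"
    and d: "\<And>\<alpha> \<beta>. \<alpha> \<in> S \<Longrightarrow> \<beta> \<in> S \<Longrightarrow> \<bar>fst \<alpha> - fst \<beta>\<bar> \<le> d \<and> \<bar>snd \<alpha> - snd \<beta>\<bar> \<le> d"
    and D: "D \<ge> 0" "\<And>i x y x' y' d. \<lbrakk>i \<le> n; \<bar>x\<bar> \<le> B; \<bar>y\<bar> \<le> B; \<bar>x'\<bar> \<le> B; \<bar>y'\<bar> \<le> B;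
    \<bar>x - x'\<bar> \<le> d; \<bar>y - y'\<bar> \<le> d\<rbrakk> \<Longrightarrow> \<bar>fst (rem2 x y i) - fst (rem2 x' y' i)\<bar> \<le> D * d \<and>
    \<bar>snd (rem2 x y i) - snd (rem2 x' y' i)\<bar> \<le> D * d"
    and w: "w = (real n * Q + 1) * (D * d)" and d0: "d \<ge> 0"
  shows "real (card S) \<le> (real n)\<^sup>2 * ((2 * Q + 1) ^ (n - 2) * (2 * w + 1)\<^sup>2)"
proof (cases "S = {}")
  case False
  then obtain x' y' where \<beta>: "(x', y') \<in> S" by fastforce
  define u where "u i = fst (rem2 x' y' i)" for i
  define v where "v i = snd (rem2 x' y' i)" for i
  have w0: "w \<ge> 0" using w Q D(1) d0 by simp
  have "\<exists>P\<in>poly_cell n Q u v w. is_min_poly P \<alpha> \<and> degree P = n" if \<alpha>: "\<alpha> \<in> S" for \<alpha>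
  proof -
    obtain x y where xy: "\<alpha> = (x, y)" by fastforce
    obtain P where P: "is_min_poly P \<alpha>" "degree P = n" "\<forall>i. \<bar>real_of_int (coeff P i)\<bar> \<le> Q"
      using \<alpha> S algebraic_integer_points_iff[OF Q] by blast
    have m: "lead_coeff P = 1" "x \<noteq> y" "poly (map_poly real_of_int P) x = 0"
      "poly (map_poly real_of_int P) y = 0"
      using P(1) by (simp_all add: is_min_poly_def xy)
    note low = low_coeffs_of_two_roots[OF m(1) P(2) n m(2-4)]
    have lip: "\<bar>u i - fst (rem2 x y i)\<bar> \<le> D * d" "\<bar>v i - snd (rem2 x y i)\<bar> \<le> D * d" if "i \<le> n" for i
      unfolding u_def v_def using D(2)[OF that, of x' y' x y d] B[OF \<alpha>] B[OF \<beta>] d[OF \<beta> \<alpha>]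
      by (simp_all add: xy)
    \<comment> \<open>Substituting the exact value of the low coefficient leaves a
      \<open>tail_comb\<close> of differences, each at most \<open>D * d\<close>.\<close>
    have "\<bar>of_int (coeff P 0) + tail_comb n (coeff P) u\<bar> \<le> w"
      unfolding low w using tail_comb_diff[of n "coeff P" u "\<lambda>i. fst (rem2 x y i)"]
        tail_comb_bound[of n "coeff P" Q "\<lambda>i. u i - fst (rem2 x y i)" "D * d"] lip P(3) Q by auto
    moreover have "\<bar>of_int (coeff P 1) + tail_comb n (coeff P) v\<bar> \<le> w"
      unfolding low w using tail_comb_diff[of n "coeff P" v "\<lambda>i. snd (rem2 x y i)"]
        tail_comb_bound[of n "coeff P" Q "\<lambda>i. v i - snd (rem2 x y i)" "D * d"] lip P(3) Q by auto
    ultimately have "P \<in> poly_cell n Q u v w"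
      using P m(1) by (auto simp: poly_cell_def)
    then show ?thesis using P by blast
  qed
  note c = card_points_le_of_polys(2)[OF poly_cell_card_le(1)[OF Q w0 n] this]
  have "real (card S) \<le> real (n\<^sup>2 * card (poly_cell n Q u v w))"
    using c of_nat_le_iff by blast
  also have "\<dots> \<le> (real n)\<^sup>2 * ((2 * Q + 1) ^ (n - 2) * (2 * w + 1)\<^sup>2)"
    using poly_cell_card_le(2)[OF Q w0 n] by (simp add: mult_left_mono)
  finally show ?thesis .
qed (use Q in simp)

text \<open>The strip is cut into about \<open>1 / h\<close> columns of width
  \<open>h = Q powr (-\<gamma>)\<close>. Each lies in a box of side of order \<open>h\<close> and
  contributes at most a constant times \<open>Q ^ (n - 2) * (Q * h)\<^sup>2\<close>, for a total of
  order \<open>Q ^ n * h\<close>.\<close>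

lemma points_near_curve_upper:
  fixes \<phi> :: "real \<Rightarrow> real"
  assumes n: "n \<ge> 2" and \<gamma>: "0 \<le> \<gamma>" "\<gamma> \<le> 1" and J: "J \<subseteq> {a<..<b}" and c: "c\<^sub>1 > 0" and L: "L \<ge> 0"
    and lip: "\<And>x y. x \<in> J \<Longrightarrow> y \<in> J \<Longrightarrow> \<bar>\<phi> x - \<phi> y\<bar> \<le> L * \<bar>x - y\<bar>"
  shows "\<exists>c\<^sub>3>0. \<forall>Q>1. real (card (points_near_curve n \<phi> c\<^sub>1 Q \<gamma> J)) < c\<^sub>3 * Q powr (real n - \<gamma>)"
proof (cases "J = {}")
  case True
  then show ?thesis by (intro exI[of _ 1]) (auto simp: points_near_curve_def)
next
  case False
  then obtain x\<^sub>0 where x0: "x\<^sub>0 \<in> J" by blast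
  have ab: "a < b" using x0 J by fastforce
  \<comment> \<open>Bounds both coordinates of every point counted: the second is within
    \<open>c\<^sub>1 * h \<le> c\<^sub>1\<close> of the curve, whose height is controlled from
    \<open>x\<^sub>0\<close>.\<close>
  define B where "B = 1 + \<bar>a\<bar> + \<bar>b\<bar> + \<bar>\<phi> x\<^sub>0\<bar> + L * (b - a) + c\<^sub>1"
  have B1: "B \<ge> 1" using ab L c by (simp add: B_def)
  obtain D where D: "D \<ge> 0" "\<And>i x y x' y' d. \<lbrakk>i \<le> n; \<bar>x\<bar> \<le> B; \<bar>y\<bar> \<le> B; \<bar>x'\<bar> \<le> B; \<bar>y'\<bar> \<le> B;
    \<bar>x - x'\<bar> \<le> d; \<bar>y - y'\<bar> \<le> d\<rbrakk> \<Longrightarrow> \<bar>fst (rem2 x y i) - fst (rem2 x' y' i)\<bar> \<le> D * d \<and>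
    \<bar>snd (rem2 x y i) - snd (rem2 x' y' i)\<bar> \<le> D * d"
    using rem2_lipschitz_uniform[OF B1, of n] by blast
  define W where "W = (real n + 1) * D * (2 * c\<^sub>1 + L + 1)"
  have W: "W \<ge> 0" using D(1) c L by (simp add: W_def)
  define C where "C = (b - a + 1) * ((real n)\<^sup>2 * (3 ^ (n - 2) * (2 * W + 1)\<^sup>2))"
  have C: "C \<ge> 0" using ab by (simp add: C_def)
  have "real (card (points_near_curve n \<phi> c\<^sub>1 Q \<gamma> J)) < (C + 1) * Q powr (real n - \<gamma>)" if Q: "Q > 1" for Q
  proof -
    define S where "S = points_near_curve n \<phi> c\<^sub>1 Q \<gamma> J"
    define h where "h = Q powr (-\<gamma>)"
    have h: "h > 0" "h \<le> 1" using Q \<gamma> by (auto simp: h_def powr_minus inverse_le_1_iff ge_one_powr_ge_zero)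
    have hQ: "Q powr \<gamma> = 1 / h" by (simp add: h_def powr_minus field_simps)
    define k where "k \<alpha> = nat \<lfloor>(fst \<alpha> - a) / h\<rfloor>" for \<alpha> :: "real \<times> real"
    define N where "N = nat \<lceil>(b - a) / h\<rceil>"
    have S: "S \<subseteq> algebraic_integer_points n Q"
      by (auto simp: S_def points_near_curve_def)
    then have finS: "finite S"
      using finite_algebraic_integer_points[of Q n] Q finite_subset by auto
    have SJ: "fst \<alpha> \<in> J" "\<bar>\<phi> (fst \<alpha>) - snd \<alpha>\<bar> < c\<^sub>1 * h" if "\<alpha> \<in> S" for \<alpha>
      using that by (auto simp: S_def points_near_curve_def h_def)
    have kN: "k \<alpha> < N" if "\<alpha> \<in> S" for \<alpha>
    proof -
      have "a < fst \<alpha>" "fst \<alpha> < b" using SJ(1)[OF that] J by auto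
      then have "(fst \<alpha> - a) / h < (b - a) / h" "0 < (fst \<alpha> - a) / h"
        using h by (auto simp: divide_strict_right_mono)
      then have "\<lfloor>(fst \<alpha> - a) / h\<rfloor> < \<lceil>(b - a) / h\<rceil>" "\<lfloor>(fst \<alpha> - a) / h\<rfloor> \<ge> 0" by linarith+
      then show ?thesis unfolding k_def N_def by linarith
    qed
    \<comment> \<open>The terms account for two vertical deviations from the curve, the variation of
      \<phi> over a column, and the column width.\<close>
    define d where "d = (2 * c\<^sub>1 + L + 1) * h"
    define w where "w = (real n * Q + 1) * (D * d)"
    have d0: "d \<ge> 0" using c L h by (simp add: d_def)
    have cell: "real (card {\<alpha> \<in> S. k \<alpha> = j}) \<le> (real n)\<^sup>2 * ((2 * Q + 1) ^ (n - 2) * (2 * w + 1)\<^sup>2)" for j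
    proof (rule card_points_in_box_le[OF n _ _ _ _ D w_def d0])
      show "Q \<ge> 0" using Q by simp
      show "{\<alpha> \<in> S. k \<alpha> = j} \<subseteq> algebraic_integer_points n Q" using S by blast
      fix \<alpha> assume "\<alpha> \<in> {\<alpha> \<in> S. k \<alpha> = j}"
      then have \<alpha>: "\<alpha> \<in> S" "k \<alpha> = j" by auto
      have ba: "a < fst \<alpha>" "fst \<alpha> < b" using SJ(1)[OF \<alpha>(1)] J by auto
      have "\<bar>fst \<alpha> - x\<^sub>0\<bar> \<le> b - a" using ba x0 J by (auto simp: abs_le_iff)
      then have "\<bar>\<phi> (fst \<alpha>) - \<phi> x\<^sub>0\<bar> \<le> L * (b - a)"
        using lip[OF SJ(1)[OF \<alpha>(1)] x0] L by (meson mult_left_mono order_trans)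
      moreover have "\<bar>\<phi> (fst \<alpha>) - snd \<alpha>\<bar> \<le> c\<^sub>1"
        using SJ(2)[OF \<alpha>(1)] h c by (smt (verit) mult_left_le)
      moreover have "L * (b - a) \<ge> 0" using L ab by simp
      ultimately show "\<bar>fst \<alpha>\<bar> \<le> B \<and> \<bar>snd \<alpha>\<bar> \<le> B"
        using ba c unfolding B_def by linarith
      fix \<beta> assume "\<beta> \<in> {\<alpha> \<in> S. k \<alpha> = j}"
      then have \<beta>: "\<beta> \<in> S" "k \<beta> = j" by auto
      have bb: "a < fst \<beta>" using SJ(1)[OF \<beta>(1)] J by auto
      have "(fst \<alpha> - a) / h > 0" "(fst \<beta> - a) / h > 0" using ba bb h by auto
      then have "\<bar>(fst \<alpha> - a) / h - (fst \<beta> - a) / h\<bar> \<le> 1"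
        using \<alpha>(2) \<beta>(2) unfolding k_def by linarith
      then have 1: "\<bar>fst \<alpha> - fst \<beta>\<bar> \<le> h"
        using h by (simp add: diff_divide_distrib[symmetric] abs_divide divide_le_eq)
      then have "L * \<bar>fst \<alpha> - fst \<beta>\<bar> \<le> L * h"
        using L by (rule mult_left_mono)
      then have "\<bar>\<phi> (fst \<alpha>) - \<phi> (fst \<beta>)\<bar> \<le> L * h"
        using lip[OF SJ(1)[OF \<alpha>(1)] SJ(1)[OF \<beta>(1)]] by linarith
      then have "\<bar>snd \<alpha> - snd \<beta>\<bar> \<le> c\<^sub>1 * h + c\<^sub>1 * h + L * h"
        using SJ(2)[OF \<alpha>(1)] SJ(2)[OF \<beta>(1)] by linarith
      moreover have "c\<^sub>1 * h \<ge> 0" "L * h \<ge> 0" using c L h by auto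
      ultimately show "\<bar>fst \<alpha> - fst \<beta>\<bar> \<le> d \<and> \<bar>snd \<alpha> - snd \<beta>\<bar> \<le> d"
        using 1 h unfolding d_def by (auto simp: algebra_simps)
    qed
    have "S = (\<Union>j<N. {\<alpha> \<in> S. k \<alpha> = j})"
      using kN by auto
    then have "card S \<le> (\<Sum>j<N. card {\<alpha> \<in> S. k \<alpha> = j})"
      by (metis card_UN_le finite_lessThan)
    then have "real (card S) \<le> (\<Sum>j<N. real (card {\<alpha> \<in> S. k \<alpha> = j}))"
      unfolding of_nat_sum[symmetric] by (rule of_nat_mono)
    also have "\<dots> \<le> (\<Sum>j<N. (real n)\<^sup>2 * ((2 * Q + 1) ^ (n - 2) * (2 * w + 1)\<^sup>2))"
      by (intro sum_mono cell)
    also have "\<dots> = real N * ((real n)\<^sup>2 * ((2 * Q + 1) ^ (n - 2) * (2 * w + 1)\<^sup>2))"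
      by simp
    also have "\<dots> \<le> ((b - a + 1) / h) * ((real n)\<^sup>2 * ((3 * Q) ^ (n - 2) * ((2 * W + 1) * (Q * h))\<^sup>2))"
    proof -
      have "real N \<le> (b - a) / h + 1"
        using ab h unfolding N_def by (simp add: of_nat_nat ceiling_le_iff less_imp_le)
      also have "\<dots> \<le> (b - a + 1) / h"
        using h by (simp add: add_divide_distrib)
      finally have 1: "real N \<le> (b - a + 1) / h" .
      \<comment> \<open>Here \<gamma> \<le> 1 enters: the additive 1 in the integer counts is
        absorbed into a multiple of \<open>Q * h\<close>.\<close>
      have Qh: "Q * h \<ge> 1"
      proof -
        have "Q * h = Q powr (1 - \<gamma>)"
          using Q by (simp add: h_def powr_diff powr_minus field_simps)
        then show ?thesis using Q \<gamma> by (simp add: ge_one_powr_ge_zero)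
      qed
      have "w \<le> ((real n + 1) * Q) * (D * d)"
        unfolding w_def using Q D(1) d0 by (intro mult_right_mono) (auto simp: algebra_simps)
      also have "\<dots> = W * (Q * h)"
        by (simp add: W_def d_def)
      finally have "2 * w + 1 \<le> (2 * W + 1) * (Q * h)"
        using Qh by (simp add: algebra_simps)
      moreover have "w \<ge> 0" using Q D(1) d0 by (simp add: w_def)
      ultimately show ?thesis
        using 1 Q h ab by (intro mult_mono power_mono) auto
    qed
    also have "\<dots> = C * (Q ^ (n - 2) * Q\<^sup>2 * h)"
      using h by (simp add: C_def field_simps power2_eq_square)
    also have "Q ^ (n - 2) * Q\<^sup>2 = Q ^ n"
      using n by (metis power_add le_add_diff_inverse2)
    also have "Q ^ n * h = Q powr (real n - \<gamma>)"
      using Q by (simp add: h_def powr_diff powr_minus powr_realpow field_simps)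
    also have "C * Q powr (real n - \<gamma>) < (C + 1) * Q powr (real n - \<gamma>)"
      using Q by simp
    finally show ?thesis by (simp add: S_def)
  qed
  then show ?thesis using C by (intro exI[of _ "C + 1"]) auto
qed

section \<open>The lower bound\<close>

text \<open>At \<open>x - u\<close> and \<open>x + u\<close> the product
  \<open>(t - x) * (t - y)\<close> has opposite signs and absolute value at least
  \<open>u * (\<delta> - u)\<close>. Multiplied by \<open>G \<ge> g\<close> it outweighs
  \<open>l\<close>, so the intermediate value theorem applies.\<close>

lemma sign_change_root:
  fixes p :: "real poly"
  assumes p: "\<And>t. \<bar>t - x\<bar> \<le> u \<Longrightarrow> poly p t = (t - x) * (t - y) * G t + l t"
    and G: "\<And>t. \<bar>t - x\<bar> \<le> u \<Longrightarrow> G t \<ge> g" and l: "\<And>t. \<bar>t - x\<bar> \<le> u \<Longrightarrow> \<bar>l t\<bar> \<le> m"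
    and u: "0 < u" "u < \<delta>" and \<delta>: "\<bar>x - y\<bar> \<ge> \<delta>" and g: "g > 0" and big: "u * (\<delta> - u) * g > m"
  obtains z where "\<bar>z - x\<bar> < u" "poly p z = 0"
proof -
  have mono: "s * G t > m" if "s \<ge> u * (\<delta> - u)" "\<bar>t - x\<bar> \<le> u" for s t
  proof -
    have "u * (\<delta> - u) > 0" using u by simp
    then have "s > 0" using that by linarith
    have "u * (\<delta> - u) * g \<le> s * G t"
      using that G[OF that(2)] u g \<open>s > 0\<close> by (intro mult_mono) auto
    then show ?thesis using big by linarith
  qed
  have t: "\<bar>(x + u) - x\<bar> \<le> u" "\<bar>(x - u) - x\<bar> \<le> u" using u by auto
  have "poly p (x - u) * poly p (x + u) < 0"
  proof (cases "x > y")
    case True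
    then have "u * (\<delta> - u) \<le> u * (x + u - y)" "u * (\<delta> - u) \<le> u * (x - u - y)"
      using \<delta> u by auto
    then have "poly p (x + u) > 0" "poly p (x - u) < 0"
      using mono[OF _ t(1)] mono[OF _ t(2)] p[OF t(1)] p[OF t(2)] l[OF t(1)] l[OF t(2)] by fastforce+
    then show ?thesis by (simp add: mult_neg_pos)
  next
    case False
    then have "u * (\<delta> - u) \<le> u * (y - x - u)" "u * (\<delta> - u) \<le> u * (y - x + u)"
      using \<delta> u by auto
    note mono[OF this(1) t(1)] mono[OF this(2) t(2)]
    moreover have "u * (y - x - u) * G (x + u) = - (u * (x + u - y) * G (x + u))"
      by (simp add: algebra_simps)
    moreover have "u * (y - x + u) * G (x - u) = - u * (x - u - y) * G (x - u)"
      by (simp add: algebra_simps)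
    ultimately have "poly p (x + u) < 0" "poly p (x - u) > 0"
      using p[OF t(1)] p[OF t(2)] l[OF t(1)] l[OF t(2)] by (auto simp: abs_le_iff)
    then show ?thesis by (simp add: mult_pos_neg)
  qed
  then obtain z where "x - u < z" "z < x + u" "poly p z = 0"
    using poly_IVT[of "x - u" "x + u" p] u by auto
  then show ?thesis by (intro that[of z]) auto
qed

text \<open>The quadratic coefficient of \<open>P\<close> therefore enters the quotient with weight
  exactly 1, which lets it dominate.\<close>

lemma quo2_two: "quo2 x y t 2 = 1"
  by (simp add: numeral_2_eq_2)

text \<open>Every polynomial of a suitable \<open>eisenstein_cell\<close> has one root near
  \<open>x\<close> and one near \<open>y\<close>, and distinct polynomials give distinct points. The
  factor \<eta> keeps the height below \<open>Q\<close>, \<epsilon> makes the higher coefficients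
  negligible in the quotient against the quadratic one, and \<open>K\<close> makes the boxes wide
  enough for the sign changes.\<close>

lemma card_points_in_box_ge:
  assumes n: "n \<ge> 3" and B: "B \<ge> 1" and xyB: "\<bar>x\<bar> + 1 \<le> B" "\<bar>y\<bar> + 1 \<le> B"
    and \<delta>: "0 < \<delta>" "\<delta> \<le> \<bar>x - y\<bar>"
    and M: "M = (4 * B\<^sup>2) ^ n" and \<eta>: "\<eta> = 1 / (16 * real n * M)" and \<epsilon>: "\<epsilon> = \<eta> / (4 * real n * M)"
    and K: "K = 2 * (2 + B) / (\<delta> * \<eta>)"
    and Q: "\<epsilon> * Q \<ge> 2" "2 * M \<le> \<eta> * Q" and h: "0 < h" "h \<le> 1 / 4" "K * h \<le> \<delta> / 4" "K * h \<le> 1" "Q * h \<ge> 4"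
  shows "(\<epsilon> * Q / 2) ^ (n - 2) * (Q * h)\<^sup>2 / 8 \<le>
    real (card {\<alpha> \<in> algebraic_integer_points n Q. \<bar>fst \<alpha> - x\<bar> < K * h \<and> \<bar>snd \<alpha> - y\<bar> < K * h})"
    (is "_ \<le> real (card ?S)")
proof -
  have "B\<^sup>2 \<ge> 1" using B by (rule one_le_power)
  then have B4: "4 * B\<^sup>2 \<ge> 1" by linarith
  have M1: "M \<ge> 1"
    unfolding M using B4 by (rule one_le_power)
  have nM: "real n * M \<ge> 3" using n M1 mult_mono[of 3 "real n" 1 M] by simp
  have n0: "real n > 0" and M0: "M > 0" using n M1 by auto
  have \<eta>0: "\<eta> > 0" using n0 M0 by (simp add: \<eta>)
  have \<eta>M: "real n * M * \<eta> = 1 / 16" using n0 M0 by (simp add: \<eta>)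
  have \<epsilon>0: "\<epsilon> > 0" using n0 M0 \<eta>0 by (simp add: \<epsilon>)
  have \<epsilon>M: "real n * M * \<epsilon> = \<eta> / 4" using n0 M0 by (simp add: \<epsilon>)
  have Q0: "Q > 0" using Q(1) \<epsilon>0 by (smt (verit) mult_nonneg_nonpos)
  have K0: "K > 0" using B \<delta> \<eta>0 by (simp add: K)
  have \<epsilon>\<eta>: "\<epsilon> \<le> \<eta>"
  proof -
    have "\<epsilon> * 1 \<le> \<epsilon> * (real n * M)" using nM \<epsilon>0 by (intro mult_left_mono) auto
    then show ?thesis using \<epsilon>M \<eta>0 by (simp add: mult_ac)
  qed
  have \<eta>s: "\<eta> \<le> 1 / 48"
    using nM n0 M0 by (simp add: \<eta> divide_simps mult.commute)
  \<comment> \<open>With radius \<open>\<epsilon> * Q / 2\<close>, the quadratic coefficient ranges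
    from \<open>2 * \<eta> * Q\<close> to \<open>2 * (\<eta> + \<epsilon>) * Q\<close> and the
    others up to \<open>n - 1\<close> from 0 to \<open>2 * \<epsilon> * Q\<close>.\<close>
  define c where "c i = (if i = 2 then \<eta> * Q + \<epsilon> * Q / 2 else \<epsilon> * Q / 2)" for i :: nat
  define u where "u i = fst (rem2 x y i)" for i
  define v where "v i = snd (rem2 x y i)" for i
  define E where "E = eisenstein_cell n c (\<epsilon> * Q / 2) u v (Q * h)"
  have xB: "\<bar>x\<bar> \<le> B" "\<bar>y\<bar> \<le> B" using xyB by auto
  have pw: "(4 * B\<^sup>2) ^ i \<le> M" if "i \<le> n" for i
    unfolding M using that B4 by (rule power_increasing)
  have uv: "\<bar>u i\<bar> \<le> M" "\<bar>v i\<bar> \<le> M" if "i \<le> n" for i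
    unfolding u_def v_def using rem2_quo2_bound[OF B xB xB(1), of i] pw[OF that] by auto
  have qb: "\<bar>quo2 x y t i\<bar> \<le> M" if "i \<le> n" "\<bar>t\<bar> \<le> B" for t i
    using rem2_quo2_bound[OF B xB that(2), of i] pw[OF that(1)] by auto
  have props: "lead_coeff P = 1" "degree P = n" "\<forall>i<n. even (coeff P i)" "\<not> 4 dvd coeff P 0"
    "real_of_int (coeff P 2) \<ge> 2 * (\<eta> * Q)"
    "\<And>i. i \<in> {3..<n} \<Longrightarrow> \<bar>real_of_int (coeff P i)\<bar> \<le> 2 * (\<epsilon> * Q)"
    "\<And>i. i \<in> {2..<n} \<Longrightarrow> \<bar>real_of_int (coeff P i)\<bar> \<le> 4 * (\<eta> * Q)"
    "\<bar>of_int (coeff P 0) + tail_comb n (coeff P) u\<bar> \<le> Q * h"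
    "\<bar>of_int (coeff P 1) + tail_comb n (coeff P) v\<bar> \<le> Q * h" if "P \<in> E" for P
  proof -
    have P: "lead_coeff P = 1" "degree P = n" "\<forall>i<n. even (coeff P i)" "\<not> 4 dvd coeff P 0"
      "\<And>i. i \<in> {2..<n} \<Longrightarrow> \<bar>real_of_int (coeff P i) - 2 * c i\<bar> \<le> 2 * (\<epsilon> * Q / 2)"
      "\<bar>of_int (coeff P 0) + tail_comb n (coeff P) u\<bar> \<le> Q * h"
      "\<bar>of_int (coeff P 1) + tail_comb n (coeff P) v\<bar> \<le> Q * h"
      using that by (auto simp: E_def eisenstein_cell_def)
    show "lead_coeff P = 1" "degree P = n" "\<forall>i<n. even (coeff P i)" "\<not> 4 dvd coeff P 0"
      "\<bar>of_int (coeff P 0) + tail_comb n (coeff P) u\<bar> \<le> Q * h"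
      "\<bar>of_int (coeff P 1) + tail_comb n (coeff P) v\<bar> \<le> Q * h"
      using P by auto
    have \<epsilon>\<eta>Q: "\<epsilon> * Q \<le> \<eta> * Q" "\<epsilon> * Q \<ge> 0" using \<epsilon>\<eta> Q0 \<epsilon>0 by auto
    show "real_of_int (coeff P 2) \<ge> 2 * (\<eta> * Q)"
      using P(5)[of 2] n by (auto simp: c_def)
    show small: "\<bar>real_of_int (coeff P i)\<bar> \<le> 2 * (\<epsilon> * Q)" if "i \<in> {3..<n}" for i
      using P(5)[of i] that \<epsilon>\<eta>Q by (auto simp: c_def)
    show "\<bar>real_of_int (coeff P i)\<bar> \<le> 4 * (\<eta> * Q)" if i: "i \<in> {2..<n}" for i
    proof (cases "i = 2")
      case True
      then show ?thesis using P(5)[of 2] i \<epsilon>\<eta>Q by (auto simp: c_def)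
    next
      case False
      then have "i \<in> {3..<n}" using i by auto
      then show ?thesis using small \<epsilon>\<eta>Q by fastforce
    qed
  qed
  have height: "\<bar>real_of_int (coeff P i)\<bar> \<le> Q" if P: "P \<in> E" for P i
  proof -
    have \<eta>Q: "\<eta> * Q \<le> 1 / 48 * Q" using \<eta>s Q0 by (intro mult_right_mono) auto
    have hQ: "Q * h \<le> Q * (1 / 4)" using h Q0 by (intro mult_left_mono) auto
    have T: "\<bar>tail_comb n (coeff P) s\<bar> \<le> Q / 2" if "\<And>i. i \<le> n \<Longrightarrow> \<bar>s i\<bar> \<le> M" for s
    proof -
      have "\<bar>tail_comb n (coeff P) s\<bar> \<le> (real n * (4 * (\<eta> * Q)) + 1) * M"
        using props(7)[OF P] that \<eta>0 Q0 by (intro tail_comb_bound) auto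
      also have "\<dots> = 4 * (real n * M * \<eta>) * Q + M"
        by (simp add: algebra_simps)
      also have "\<dots> \<le> Q / 2"
        unfolding \<eta>M using Q(2) \<eta>Q Q0 by linarith
      finally show ?thesis .
    qed
    have Tu: "\<bar>tail_comb n (coeff P) u\<bar> \<le> Q / 2" and Tv: "\<bar>tail_comb n (coeff P) v\<bar> \<le> Q / 2"
      using T uv by blast+
    consider "i = 0" | "i = 1" | "i \<in> {2..<n}" | "i = n" | "i > n" by force
    then show ?thesis
    proof cases
      case 1
      then show ?thesis using props(8)[OF P] Tu hQ Q0 unfolding 1 by linarith
    next
      case 2
      then show ?thesis using props(9)[OF P] Tv hQ Q0 unfolding 2 by linarith
    next
      case 3
      then show ?thesis using props(7)[OF P 3] \<eta>Q Q0 by linarith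
    next
      case 4
      then have "coeff P i = 1" using props(1,2)[OF P] by simp
      moreover have "Q \<ge> 1" using Q(2) \<eta>Q M1 by linarith
      ultimately show ?thesis by simp
    next
      case 5
      then show ?thesis using props(2)[OF P] Q0 by (simp add: coeff_eq_0)
    qed
  qed
  have quot: "tail_comb n (coeff P) (quo2 x y t) \<ge> \<eta> * Q" if P: "P \<in> E" and t: "\<bar>t\<bar> \<le> B" for P t
  proof -
    \<comment> \<open>Index 2 is split off, which is possible because \<open>n \<ge> 3\<close> keeps
      it below the leading index.\<close>
    have "tail_comb n (coeff P) (quo2 x y t) =
        of_int (coeff P 2) + tail_comb n ((coeff P)(2 := 0)) (quo2 x y t)"
    proof -
      have "{2..<n} = insert 2 {3..<n}" using n by auto
      then show ?thesis by (simp add: tail_comb_def quo2_two)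
    qed
    moreover have "\<bar>tail_comb n ((coeff P)(2 := 0)) (quo2 x y t)\<bar> \<le> (real n * (2 * (\<epsilon> * Q)) + 1) * M"
      using props(6)[OF P] qb[OF _ t] \<epsilon>0 Q0 by (intro tail_comb_bound) auto
    moreover have "(real n * (2 * (\<epsilon> * Q)) + 1) * M = 2 * (real n * M * \<epsilon>) * Q + M"
      by (simp add: algebra_simps)
    ultimately show ?thesis
      using props(5)[OF P] Q(2) unfolding \<epsilon>M by simp
  qed
  \<comment> \<open>\<open>K\<close> is chosen so that half the gap \<delta> already yields
    \<open>(2 + B) * (Q * h)\<close>, while the remainder is at most
    \<open>(1 + B) * (Q * h)\<close> on \<open>\<bar>t\<bar> \<le> B\<close>.\<close>
  have big: "K * h * (\<delta> - K * h) * (\<eta> * Q) > Q * h * (1 + B)"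
  proof -
    have "K * h * (\<delta> / 2) * (\<eta> * Q) \<le> K * h * (\<delta> - K * h) * (\<eta> * Q)"
      using h K0 \<eta>0 Q0 \<delta> by (intro mult_right_mono mult_left_mono) auto
    moreover have "K * h * (\<delta> / 2) * (\<eta> * Q) = (2 + B) * (Q * h)"
      using \<delta> \<eta>0 by (simp add: K)
    moreover have "Q * h * (1 + B) < (2 + B) * (Q * h)"
      using Q0 h by (simp add: algebra_simps)
    ultimately show ?thesis by linarith
  qed
  have Kh: "0 < K * h" "K * h < \<delta>" using K0 h \<delta> by auto
  define S where "S = ?S"
  have "\<exists>\<alpha>. \<alpha> \<in> S \<and> is_min_poly P \<alpha>" if P: "P \<in> E" for P
  proof -
    define l where "l t = (of_int (coeff P 0) + tail_comb n (coeff P) u)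
      + (of_int (coeff P 1) + tail_comb n (coeff P) v) * t" for t
    define p where "p = map_poly real_of_int P"
    define G where "G t = tail_comb n (coeff P) (quo2 x y t)" for t
    have div: "poly p t = (t - x) * (t - y) * G t + l t" for t
      unfolding p_def G_def l_def u_def v_def
      using poly_monic_division[OF props(1,2)[OF P]] n by simp
    have lb: "\<bar>l t\<bar> \<le> Q * h * (1 + B)" if "\<bar>t\<bar> \<le> B" for t
    proof -
      have "\<bar>(of_int (coeff P 1) + tail_comb n (coeff P) v) * t\<bar> \<le> (Q * h) * B"
        unfolding abs_mult using props(9)[OF P] that Q0 h by (intro mult_mono) auto
      then show ?thesis
        using props(8)[OF P] unfolding l_def by (simp add: algebra_simps)
    qed
    have near: "\<bar>t\<bar> \<le> B" if "\<bar>t - x\<bar> \<le> K * h \<or> \<bar>t - y\<bar> \<le> K * h" for t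
      using that xyB h(4) by linarith
    obtain z where z: "\<bar>z - x\<bar> < K * h" "poly p z = 0"
      using sign_change_root[of x "K * h" p y G l "\<eta> * Q" "Q * h * (1 + B)" \<delta>]
        div quot[OF P] lb near Kh \<delta> \<eta>0 Q0 big unfolding G_def by auto
    \<comment> \<open>The decomposition is symmetric in the two points, so the same \<open>G\<close>
      and \<open>l\<close> give the root near \<open>y\<close>.\<close>
    have div': "poly p t = (t - y) * (t - x) * G t + l t" for t
      unfolding div by simp
    obtain z' where z': "\<bar>z' - y\<bar> < K * h" "poly p z' = 0"
      using sign_change_root[of y "K * h" p x G l "\<eta> * Q" "Q * h * (1 + B)" \<delta>]
        div' quot[OF P] lb near Kh \<delta> \<eta>0 Q0 big unfolding G_def by (auto simp: abs_minus_commute)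
    have "z \<noteq> z'"
      using z(1) z'(1) \<delta> h(3) by auto
    moreover have "irreducible (map_poly rat_of_int P)"
      using props(1-4)[OF P] n by (intro eisenstein_two) auto
    ultimately have "is_min_poly P (z, z')"
      using z(2) z'(2) props(1)[OF P] by (simp add: is_min_poly_def p_def)
    then show ?thesis
      using z(1) z'(1) height[OF P] props(2)[OF P] Q0
      by (intro exI[of _ "(z, z')"]) (auto simp: S_def algebraic_integer_points_iff)
  qed
  then obtain f where f: "\<And>P. P \<in> E \<Longrightarrow> f P \<in> S \<and> is_min_poly P (f P)"
    by metis
  have "inj_on f E"
    using f is_min_poly_unique by (metis inj_onI)
  moreover have "f ` E \<subseteq> S" using f by blast
  \<comment> \<open>Finiteness of the cell is inherited from \<open>S\<close> through the injection
    \<open>f\<close>.\<close>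
  moreover have finS: "finite S"
    using finite_algebraic_integer_points[of Q n] Q0 by (auto simp: S_def)
  ultimately have "card E \<le> card S" and finE: "finite E"
    by (auto intro: card_inj_on_le inj_on_finite)
  moreover have "(\<epsilon> * Q / 2) ^ (n - 2) * (Q * h)\<^sup>2 / 8 \<le> real (card E)"
    unfolding E_def using n Q(1) h(5) finE by (intro eisenstein_cell_card_ge) (auto simp: E_def)
  ultimately show ?thesis unfolding S_def by linarith
qed

text \<open>About \<open>1 / h\<close> boxes of half-width \<open>K * h\<close> are centred on the
  curve over consecutive intervals. They are disjoint, lie in the strip once
  \<open>c\<^sub>1 \<ge> C\<close>, and each holds at least a constant times
  \<open>Q ^ (n - 2) * (Q * h)\<^sup>2\<close> points.\<close>

lemma points_near_curve_lower:
  fixes \<phi> :: "real \<Rightarrow> real"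
  assumes n: "n \<ge> 3" and \<gamma>: "0 < \<gamma>" "\<gamma> < 1" and pq: "p < q" "{p..q} \<subseteq> J" and L: "L \<ge> 0"
    and lip: "\<And>x y. x \<in> {p..q} \<Longrightarrow> y \<in> {p..q} \<Longrightarrow> \<bar>\<phi> x - \<phi> y\<bar> \<le> L * \<bar>x - y\<bar>"
    and \<delta>: "\<delta> > 0" "\<And>x. x \<in> {p..q} \<Longrightarrow> \<bar>x - \<phi> x\<bar> \<ge> \<delta>"
  shows "\<exists>C>0. \<forall>c\<^sub>1\<ge>C. \<exists>c\<^sub>2>0. \<exists>Q\<^sub>0\<ge>1. \<forall>Q>Q\<^sub>0.
    c\<^sub>2 * Q powr (real n - \<gamma>) < real (card (points_near_curve n \<phi> c\<^sub>1 Q \<gamma> J))"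
proof -
  have n2: "2 \<le> n" using n by simp
  define B where "B = 1 + \<bar>p\<bar> + \<bar>q\<bar> + \<bar>\<phi> p\<bar> + L * (q - p)"
  have B1: "B \<ge> 1" using L pq by (simp add: B_def)
  have xB: "\<bar>x\<bar> + 1 \<le> B \<and> \<bar>\<phi> x\<bar> + 1 \<le> B" if "x \<in> {p..q}" for x
  proof -
    have "L * \<bar>x - p\<bar> \<le> L * (q - p)" using that L by (intro mult_left_mono) auto
    then have "\<bar>\<phi> x - \<phi> p\<bar> \<le> L * (q - p)"
      using lip[OF that, of p] pq by auto
    moreover have "0 \<le> L * (q - p)" using L pq by simp
    ultimately show ?thesis using that unfolding B_def by auto
  qed
  define M where "M = (4 * B\<^sup>2) ^ n"
  define \<eta> where "\<eta> = 1 / (16 * real n * M)"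
  define \<epsilon> where "\<epsilon> = \<eta> / (4 * real n * M)"
  define K where "K = 2 * (2 + B) / (\<delta> * \<eta>)"
  have M0: "M > 0" using B1 by (simp add: M_def)
  have pos: "\<eta> > 0" "\<epsilon> > 0" "K > 0"
    using M0 n B1 \<delta> by (simp_all add: \<eta>_def \<epsilon>_def K_def)
  \<comment> \<open>A point of a box is off the curve by at most \<open>K * h\<close> vertically
    plus \<open>L * (K * h)\<close> from the shift of its abscissa.\<close>
  define C where "C = (L + 1) * K"
  define c where "c = (q - p) / (4 * K) * ((\<epsilon> / 2) ^ (n - 2) / 8)"
  have c0: "c > 0" using pq pos by (simp add: c_def)
  \<comment> \<open>The first three bounds on \<open>h\<close> are what a single box requires; the
    last makes room for enough boxes.\<close>
  define e where "e = Min {1 / 4, \<delta> / (4 * K), 1 / K, (q - p) / (4 * K)}"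
  have e0: "e > 0" using \<delta> pq pos by (simp add: e_def)
  have "\<forall>\<^sub>F Q in at_top. Q powr (-\<gamma>) < e"
    using \<gamma> e0 by (intro order_tendstoD(2)[OF tendsto_neg_powr]) (auto intro: filterlim_ident)
  \<comment> \<open>This becomes \<open>Q * h \<ge> 4\<close>, the minimal width for the count of
    low coefficients; it relies on \<gamma> < 1.\<close>
  moreover have "\<forall>\<^sub>F Q in at_top. Q powr (-(1-\<gamma>)) < 1 / 4"
    using \<gamma> by (intro order_tendstoD(2)[OF tendsto_neg_powr]) (auto intro: filterlim_ident)
  moreover have "\<forall>\<^sub>F Q::real in at_top. Q \<ge> max 1 (max (2 / \<epsilon>) (2 * M / \<eta>))"
    by (rule eventually_ge_at_top)
  ultimately have "\<forall>\<^sub>F Q in at_top. Q powr (-\<gamma>) < e \<and> Q powr (-(1-\<gamma>)) < 1 / 4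
      \<and> Q \<ge> max 1 (max (2 / \<epsilon>) (2 * M / \<eta>))"
    by eventually_elim auto
  then obtain Q\<^sub>1 where Q1: "\<And>Q. Q \<ge> Q\<^sub>1 \<Longrightarrow> Q powr (-\<gamma>) < e \<and> Q powr (-(1-\<gamma>)) < 1 / 4
      \<and> Q \<ge> max 1 (max (2 / \<epsilon>) (2 * M / \<eta>))"
    unfolding eventually_at_top_linorder by blast
  have main: "c / 2 * Q powr (real n - \<gamma>) < real (card (points_near_curve n \<phi> c\<^sub>1 Q \<gamma> J))"
    if c1: "c\<^sub>1 \<ge> C" and Q: "Q > max 1 Q\<^sub>1" for c\<^sub>1 Q
  proof -
    define h where "h = Q powr (-\<gamma>)"
    have h0: "h > 0" using Q by (simp add: h_def)
    have QQ: "Q > 1" "h < e" "Q powr (-(1-\<gamma>)) < 1 / 4" "Q \<ge> 2 / \<epsilon>" "Q \<ge> 2 * M / \<eta>"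
      using Q Q1[of Q] by (auto simp: h_def)
    have he: "h \<le> 1 / 4" "h \<le> \<delta> / (4 * K)" "h \<le> 1 / K" "h \<le> (q - p) / (4 * K)"
      using QQ(2) unfolding e_def by auto
    have hK: "K * h \<le> \<delta> / 4" "K * h \<le> 1" "4 * (K * h) \<le> q - p"
      using he pos by (auto simp: field_simps)
    have Q2: "\<epsilon> * Q \<ge> 2" "2 * M \<le> \<eta> * Q"
      using QQ(4,5) pos by (auto simp: field_simps)
    have "Q * h = Q powr (1 - \<gamma>)"
      using QQ(1) by (simp add: h_def powr_diff powr_minus field_simps)
    also have "\<dots> = 1 / Q powr (-(1-\<gamma>))"
      by (simp only: powr_minus) (simp add: field_simps)
    also have "\<dots> \<ge> 4"
      using QQ(1,3) pos_le_divide_eq[of "Q powr (-(1-\<gamma>))" 4 1] by simp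
    finally have Qh: "Q * h \<ge> 4" .
    define S where "S = points_near_curve n \<phi> c\<^sub>1 Q \<gamma> J"
    define x where "x k = p + (2 * real k + 1) * (K * h)" for k :: nat
    define N where "N = nat \<lfloor>(q - p) / (2 * (K * h))\<rfloor>"
    have Kh: "K * h > 0" using pos h0 by simp
    define T where "T k = {\<alpha> \<in> algebraic_integer_points n Q.
      \<bar>fst \<alpha> - x k\<bar> < K * h \<and> \<bar>snd \<alpha> - \<phi> (x k)\<bar> < K * h}" for k
    have Nle: "real N * (2 * (K * h)) \<le> q - p"
    proof -
      have "real N \<le> (q - p) / (2 * (K * h))"
        unfolding N_def using pq Kh by (simp add: of_nat_nat)
      then show ?thesis using Kh by (simp add: pos_le_divide_eq)
    qed
    have xk: "p \<le> x k - K * h" "x k + K * h \<le> q" if "k < N" for k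
    proof -
      have "0 \<le> real k * (K * h)" using Kh by simp
      then show "p \<le> x k - K * h" by (simp add: x_def algebra_simps)
      have "real (k + 1) * (2 * (K * h)) \<le> real N * (2 * (K * h))"
        using that Kh by (intro mult_right_mono) auto
      then show "x k + K * h \<le> q" using Nle by (simp add: x_def algebra_simps)
    qed
    have TS: "T k \<subseteq> S" if k: "k < N" for k
    proof
      fix \<alpha> assume \<alpha>: "\<alpha> \<in> T k"
      then have a: "\<alpha> \<in> algebraic_integer_points n Q" "\<bar>fst \<alpha> - x k\<bar> < K * h" "\<bar>snd \<alpha> - \<phi> (x k)\<bar> < K * h"
        by (auto simp: T_def)
      have f: "fst \<alpha> \<in> {p..q}" "x k \<in> {p..q}" using a(2) xk[OF k] Kh by auto
      have "L * \<bar>fst \<alpha> - x k\<bar> \<le> L * (K * h)"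
        using a(2) L by (intro mult_left_mono) auto
      then have "\<bar>\<phi> (fst \<alpha>) - snd \<alpha>\<bar> < L * (K * h) + K * h"
        using lip[OF f] a(3) by linarith
      also have "\<dots> = C * h" by (simp add: C_def algebra_simps)
      also have "\<dots> \<le> c\<^sub>1 * h" using c1 h0 by simp
      finally show "\<alpha> \<in> S"
        using a(1) f pq(2) by (auto simp: S_def points_near_curve_def h_def)
    qed
    have finS: "finite S"
      by (rule finite_subset[OF _ finite_algebraic_integer_points[of Q n]])
        (use QQ(1) in \<open>auto simp: S_def points_near_curve_def\<close>)
    \<comment> \<open>The boxes are open, so it is enough that their projections at most
      touch.\<close>
    have disj: "T j \<inter> T k = {}" if "j < k" for j k
    proof -
      have "real (j + 1) \<le> real k" using that by linarith
      then have "real (j + 1) * (2 * (K * h)) \<le> real k * (2 * (K * h))"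
        using Kh by (intro mult_right_mono) auto
      then have "x j + K * h \<le> x k - K * h"
        by (simp add: x_def algebra_simps)
      then show ?thesis by (auto simp: T_def)
    qed
    have cell: "(\<epsilon> * Q / 2) ^ (n - 2) * (Q * h)\<^sup>2 / 8 \<le> real (card (T k))" if k: "k < N" for k
    proof -
      have f: "x k \<in> {p..q}" using xk[OF k] Kh by auto
      show ?thesis
        unfolding T_def
        by (rule card_points_in_box_ge[OF n B1 _ _ \<delta>(1) \<delta>(2)[OF f] M_def \<eta>_def \<epsilon>_def K_def Q2 h0 he(1) hK(1,2) Qh])
          (use xB[OF f] in auto)
    qed
    have "c * Q powr (real n - \<gamma>) = (q - p) / (4 * (K * h)) * ((\<epsilon> * Q / 2) ^ (n - 2) * (Q * h)\<^sup>2 / 8)"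
    proof -
      have "Q powr (real n - \<gamma>) = Q ^ n * h"
        using QQ(1) by (simp add: h_def powr_diff powr_minus powr_realpow field_simps)
      also have "Q ^ n = Q ^ (n - 2) * Q\<^sup>2" 
        by (metis power_add le_add_diff_inverse2 n2)
      finally show ?thesis
        using h0 pos by (simp add: c_def power_mult_distrib power_divide field_simps power2_eq_square)
    qed
    also have "\<dots> \<le> real N * ((\<epsilon> * Q / 2) ^ (n - 2) * (Q * h)\<^sup>2 / 8)"
    proof (rule mult_right_mono)
      \<comment> \<open>Rounding down loses at most 1, which is no more than half of the
        quotient.\<close>
      have "(q - p) / (2 * (K * h)) - 1 \<le> real N"
        unfolding N_def by linarith
      moreover have "1 \<le> (q - p) / (4 * (K * h))"
        using hK(3) Kh by (simp add: pos_le_divide_eq)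
      moreover have "(q - p) / (2 * (K * h)) = 2 * ((q - p) / (4 * (K * h)))"
        using pos h0 by (simp add: divide_simps)
      ultimately show "(q - p) / (4 * (K * h)) \<le> real N" by linarith
    qed (use pos QQ(1) in auto)
    also have "\<dots> = (\<Sum>k<N. (\<epsilon> * Q / 2) ^ (n - 2) * (Q * h)\<^sup>2 / 8)"
      by simp
    also have "\<dots> \<le> (\<Sum>k<N. real (card (T k)))"
      using cell by (intro sum_mono) auto
    also have "\<dots> = real (card (\<Union>k<N. T k))"
    proof -
      have "card (\<Union>k<N. T k) = (\<Sum>k<N. card (T k))"
        using TS finS disj by (intro card_UN_disjoint)
          (auto intro: finite_subset, metis disjoint_iff linorder_neqE_nat)
      then show ?thesis by simp
    qed
    also have "\<dots> \<le> real (card S)"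
      using TS finS by (intro of_nat_mono card_mono) auto
    finally have "c * Q powr (real n - \<gamma>) \<le> real (card S)" .
    \<comment> \<open>Halving \<open>c\<close> makes the inequality strict.\<close>
    moreover have "c / 2 * Q powr (real n - \<gamma>) < c * Q powr (real n - \<gamma>)"
      using c0 QQ(1) by simp
    ultimately show ?thesis by (simp add: S_def)
  qed
  have "C > 0" using L pos by (simp add: C_def)
  moreover have "\<exists>c\<^sub>2>0. \<exists>Q\<^sub>0\<ge>1. \<forall>Q>Q\<^sub>0.
      c\<^sub>2 * Q powr (real n - \<gamma>) < real (card (points_near_curve n \<phi> c\<^sub>1 Q \<gamma> J))" if "c\<^sub>1 \<ge> C" for c\<^sub>1
    using main[OF that] c0 by (intro exI[of _ "c / 2"] conjI exI[of _ "max 1 Q\<^sub>1"]) auto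
  ultimately show ?thesis by blast
qed

section \<open>Lipschitz bound, a segment away from the fixed points, and assembly of the two
  estimates\<close>

theorem theorem1:
  fixes a b :: real and \<phi> :: "real \<Rightarrow> real" and J :: "real set"
    and n :: nat and \<gamma> :: real
  assumes "\<phi> C1_differentiable_on {a<..<b}"
    and "bdd_above ((\<lambda>x. \<bar>deriv \<phi> x\<bar>) ` {a<..<b})"
    and "finite {x \<in> {a<..<b}. \<phi> x = x}"
    and "is_interval J" and "J \<subseteq> {a<..<b}" and "measure lborel J > 0"
    and "n \<ge> 3" and "0 < \<gamma>" and "\<gamma> < 1"
  shows "\<exists>C>0. \<forall>c\<^sub>1\<ge>C. \<exists>c\<^sub>2>0. \<exists>c\<^sub>3>0. \<exists>Q\<^sub>0\<ge>1. \<forall>Q>Q\<^sub>0.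
           c\<^sub>2 * Q powr (real n - \<gamma>) < real (card (points_near_curve n \<phi> c\<^sub>1 Q \<gamma> J)) \<and>
           real (card (points_near_curve n \<phi> c\<^sub>1 Q \<gamma> J)) < c\<^sub>3 * Q powr (real n - \<gamma>)"
proof -
  obtain D where D: "\<And>x. x \<in> {a<..<b} \<Longrightarrow> (\<phi> has_real_derivative D x) (at x)"
    using assms(1) unfolding C1_differentiable_on_def has_real_derivative_iff_has_vector_derivative
    by blast
  obtain L' where L': "\<And>x. x \<in> {a<..<b} \<Longrightarrow> \<bar>deriv \<phi> x\<bar> \<le> L'"
    using assms(2) unfolding bdd_above_def by blast
  define L where "L = max 0 L'"
  have L0: "L \<ge> 0" by (simp add: L_def)
  have lip: "\<bar>\<phi> x - \<phi> y\<bar> \<le> L * \<bar>x - y\<bar>" if "x \<in> {a<..<b}" "y \<in> {a<..<b}" for x y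
  proof -
    have "norm (\<phi> x - \<phi> y) \<le> L * norm (x - y)"
    proof (rule field_differentiable_bound[of "{a<..<b}" \<phi> D])
      fix z assume z: "z \<in> {a<..<b}"
      show "(\<phi> has_field_derivative D z) (at z within {a<..<b})"
        using D[OF z] by (rule has_field_derivative_at_within)
      show "norm (D z) \<le> L"
        using L'[OF z] DERIV_imp_deriv[OF D[OF z]] by (simp add: L_def)
    qed (use that in auto)
    then show ?thesis by simp
  qed
  obtain p\<^sub>0 q\<^sub>0 where p0: "p\<^sub>0 \<in> J" "q\<^sub>0 \<in> J" "p\<^sub>0 < q\<^sub>0"
  proof -
    \<comment> \<open>A set with at most one point has measure zero, so positive measure yields two
      points of \<open>J\<close>.\<close>
    have "\<not> (\<exists>s. J \<subseteq> {s})"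
    proof
      assume "\<exists>s. J \<subseteq> {s}"
      then have "J = {} \<or> (\<exists>s. J = {s})" by blast
      then show False using assms(6) by auto
    qed
    then obtain s t where "s \<in> J" "t \<in> J" "s \<noteq> t" by blast
    then show ?thesis using that[of s t] that[of t s] by linarith
  qed
  have sub: "{p\<^sub>0..q\<^sub>0} \<subseteq> J"
    using assms(4) p0(1,2) mem_is_interval_1_I by (metis atLeastAtMost_iff subsetI)
  \<comment> \<open>Finitely many fixed points cannot fill an open interval, so some
    \<open>z\<close> in it is moved by \<phi>.\<close>
  have "infinite {p\<^sub>0<..<q\<^sub>0}" using p0 by simp
  then have "\<not> {p\<^sub>0<..<q\<^sub>0} \<subseteq> {x \<in> {a<..<b}. \<phi> x = x}"
    using assms(3) finite_subset by blast
  moreover have "{p\<^sub>0<..<q\<^sub>0} \<subseteq> {a<..<b}"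
    using sub assms(5) by (meson atLeastAtMost_iff greaterThanLessThan_iff less_imp_le subset_eq)
  ultimately obtain z where z: "z \<in> {p\<^sub>0<..<q\<^sub>0}" "\<phi> z \<noteq> z"
    by blast
  define \<delta> where "\<delta> = \<bar>z - \<phi> z\<bar> / 2"
  have \<delta>0: "\<delta> > 0" using z by (simp add: \<delta>_def)
  \<comment> \<open>\<open>x - \<phi> x\<close> is Lipschitz with constant \<open>L + 1\<close>, so
    within \<open>r\<close> of \<open>z\<close> it loses at most \<delta>, half of its value at
    \<open>z\<close>.\<close>
  define r where "r = min (\<delta> / (L + 1)) (q\<^sub>0 - z)"
  have r: "r > 0" "(L + 1) * r \<le> \<delta>" "r \<le> q\<^sub>0 - z"
  proof -
    show "r > 0" using z(1) \<delta>0 L0 by (simp add: r_def)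
    have "r \<le> \<delta> / (L + 1)" by (simp add: r_def)
    then show "(L + 1) * r \<le> \<delta>" using L0 by (simp add: pos_le_divide_eq mult.commute)
  qed (simp add: r_def)
  have pq: "{z..z + r} \<subseteq> J" using sub z r by auto
  then have pqab: "{z..z + r} \<subseteq> {a<..<b}" using assms(5) by blast
  have far: "\<bar>x - \<phi> x\<bar> \<ge> \<delta>" if x: "x \<in> {z..z + r}" for x
  proof -
    have "\<bar>\<phi> x - \<phi> z\<bar> \<le> L * \<bar>x - z\<bar>"
      using x r(1) by (intro lip subsetD[OF pqab]) auto
    also have "\<dots> \<le> L * r" using x L0 by (intro mult_left_mono) auto
    finally have "\<bar>\<phi> x - \<phi> z\<bar> + \<bar>x - z\<bar> \<le> (L + 1) * r"
      using x by (simp add: algebra_simps)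
    then have "\<bar>\<phi> x - \<phi> z\<bar> + \<bar>x - z\<bar> \<le> \<delta>" using r(2) by linarith
    moreover have "\<bar>z - \<phi> z\<bar> = 2 * \<delta>" by (simp add: \<delta>_def)
    ultimately show ?thesis by linarith
  qed
  have "\<exists>C>0. \<forall>c\<^sub>1\<ge>C. \<exists>c\<^sub>2>0. \<exists>Q\<^sub>0\<ge>1. \<forall>Q>Q\<^sub>0.
      c\<^sub>2 * Q powr (real n - \<gamma>) < real (card (points_near_curve n \<phi> c\<^sub>1 Q \<gamma> J))"
  proof (rule points_near_curve_lower[OF assms(7-9) _ pq L0 _ \<delta>0 far])
    show "z < z + r" using r by simp
    show "\<bar>\<phi> x - \<phi> y\<bar> \<le> L * \<bar>x - y\<bar>" if "x \<in> {z..z + r}" "y \<in> {z..z + r}" for x y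
      using that pqab by (intro lip) blast+
  qed
  then obtain C where C: "C > 0" and low: "\<And>c\<^sub>1. c\<^sub>1 \<ge> C \<Longrightarrow> \<exists>c\<^sub>2>0. \<exists>Q\<^sub>0\<ge>1. \<forall>Q>Q\<^sub>0.
      c\<^sub>2 * Q powr (real n - \<gamma>) < real (card (points_near_curve n \<phi> c\<^sub>1 Q \<gamma> J))"
    by blast
  show ?thesis
  proof (rule exI[of _ C], intro conjI C allI impI)
    fix c\<^sub>1 assume c1: "c\<^sub>1 \<ge> C"
    obtain c\<^sub>2 Q\<^sub>0 where c2: "c\<^sub>2 > 0" "Q\<^sub>0 \<ge> 1" "\<And>Q. Q > Q\<^sub>0 \<Longrightarrow>
        c\<^sub>2 * Q powr (real n - \<gamma>) < real (card (points_near_curve n \<phi> c\<^sub>1 Q \<gamma> J))"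
      using low[OF c1] by blast
    have "\<exists>c\<^sub>3>0. \<forall>Q>1. real (card (points_near_curve n \<phi> c\<^sub>1 Q \<gamma> J)) < c\<^sub>3 * Q powr (real n - \<gamma>)"
    proof (rule points_near_curve_upper[OF _ _ _ assms(5) _ L0])
      show "\<bar>\<phi> x - \<phi> y\<bar> \<le> L * \<bar>x - y\<bar>" if "x \<in> J" "y \<in> J" for x y
        using that assms(5) by (intro lip) blast+
    qed (use assms(7-9) C c1 in auto)
    then obtain c\<^sub>3 where c3: "c\<^sub>3 > 0" "\<And>Q. Q > 1 \<Longrightarrow>
        real (card (points_near_curve n \<phi> c\<^sub>1 Q \<gamma> J)) < c\<^sub>3 * Q powr (real n - \<gamma>)"
      by blast
    show "\<exists>c\<^sub>2>0. \<exists>c\<^sub>3>0. \<exists>Q\<^sub>0\<ge>1. \<forall>Q>Q\<^sub>0.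
        c\<^sub>2 * Q powr (real n - \<gamma>) < real (card (points_near_curve n \<phi> c\<^sub>1 Q \<gamma> J)) \<and>
        real (card (points_near_curve n \<phi> c\<^sub>1 Q \<gamma> J)) < c\<^sub>3 * Q powr (real n - \<gamma>)"
      by (rule exI[of _ c\<^sub>2], intro conjI c2(1), rule exI[of _ c\<^sub>3], intro conjI c3(1),
          rule exI[of _ Q\<^sub>0]) (use c2 c3 in auto)
  qed
qed

end
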